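(* Let $\mathcal{X}$ be a finite or countably infinite alphabet, and let $0<\gamma<1$ and $0<\beta<\frac{1-\gamma}{2}$ be arbitrary. Let $\{X_n\}_{n=-\infty}^{\infty}$ be a stationary and ergodic time series taking values in $\mathcal{X}$, and let $\chi_n=\chi_n(X_0,\dots,X_n)$ be the order estimator with parameters $\gamma,\beta$ defined in the context. (i) If $\{X_n\}$ is a Markov chain of some finite order $K\ge 0$, then almost surely $\chi_n=K$ for all sufficiently large $n$. (ii) If $\{X_n\}$ is not a Markov chain of any finite order, then $\chi_n\to\infty$ almost surely as $n\to\infty$.
   Context: Notation: $X_m^n=(X_m,\dots,X_n)$ for $m\le n$, and $X_m^n$ is the empty string if $m>n$; likewise for deterministic strings $x_m^n$, $z_m^n$. For $k\ge 0$, $p(x_{-k}^0)=P(X_{-k}^0=x_{-k}^0)$ and $p(y|x_{-k}^0)=P(X_1=y\mid X_{-k}^0=x_{-k}^0)$; conditioning on the empty string means no conditioning, so that $p(y|z_{1}^0)=P(X_1=y)$, and the empty string has probability $1$. Markov chain and order: the stationary time series $\{X_n\}$ with values in $\mathcal{X}$ is said to be a Markov chain if for some integer $K\ge 0$, for all $y\in\mathcal{X}$, all $i\ge 1$ and all $z_{-K-i+1}^0\in\mathcal{X}^{K+i}$ with $p(z_{-K-i+1}^0)>0$, one has $p(y|z_{-K+1}^0)=p(y|z_{-K-i+1}^0)$. The order of the Markov chain is the smallest such $K$ (order $0$ thus means i.i.d.). The estimator: fix $0<\gamma<1$ and $0<\beta<\frac{1-\gamma}{2}$. For $n\ge 1$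 and $k\ge 0$ define the following sets of strings of length $k+1$: $$\mathcal{S}_{n,k}^{(1)}=\{x_{-k}^0\in\mathcal{X}^{k+1}:\ \exists\, t \text{ with } k\le t\le \lceil n/2\rceil-1 \text{ and } X_{t-k}^t=x_{-k}^0\},$$ $$\mathcal{S}_{n,k}^{(2)}=\{x_{-k}^0\in\mathcal{X}^{k+1}:\ \#\{\lceil n/2\rceil+k\le t\le n:\ X_{t-k}^t=x_{-k}^0\}>n^{1-\gamma}\},$$ $$\mathcal{S}_k^n=\mathcal{S}_{n,k}^{(1)}\cap\mathcal{S}_{n,k}^{(2)}.$$ For integers $n_1\le n_2$, $k\ge 0$, $x\in\mathcal{X}$ and $z_{-k+1}^0\in\mathcal{X}^k$, the empirical conditional probability computed from the samples $X_{n_1},\dots,X_{n_2}$ is $$C(x|z_{-k+1}^0:[n_1,n_2])=\frac{\#\{n_1+k\le t\le n_2:\ X_{t-k}^t=(z_{-k+1}^0,x)\}}{\#\{n_1+k-1\le t\le n_2-1:\ X_{t-k+1}^t=z_{-k+1}^0\}},$$ where $0/0$ is defined as $0$ (for $k=0$ the string $z_{1}^0$ is empty and every $t$ in the range is counted in the denominator). Define $$\hat\Delta_k^n=\max_{1\le i\le n}\ \max_{(z_{-k-i+1}^0,x)\in\mathcal{S}_{k+i}^n}\left|C(x|z_{-k+1}^0:[\lceil n/2\rceil,n])-C(x|z_{-k-i+1}^0:[\lceil n/2\rceil,n])\right|,$$ where $(z_{-k-i+1}^0,x)$ denotes the string of length $k+i+1$ obtained by appending the letter $x$ to $z_{-k-i+1}^0\in\mathcal{X}^{k+i}$,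 $z_{-k+1}^0$ denotes the suffix of length $k$ of $z_{-k-i+1}^0$, and a maximum over an empty set is $0$. Set $\chi_0=0$, and for $n\ge 1$ let $\chi_n$ be the smallest integer $k_n$ with $0\le k_n<n$ such that $\hat\Delta_{k_n}^n\le n^{-\beta}$. *)

theory Defs
  imports "HOL-Probability.Probability"
begin

section \<open>Stationary and ergodic time series over a countable alphabet\<close>

text \<open>The alphabet is a type \<open>'a::countable\<close>, i.e. finite or countably infinite, with its
  discrete sigma-algebra; a two-sided time series is a function \<open>X :: int \<Rightarrow> 'w \<Rightarrow> 'a\<close>.\<close>

definition time_series :: "'w measure \<Rightarrow> (int \<Rightarrow> 'w \<Rightarrow> 'a) \<Rightarrow> bool" where
  "time_series M X \<longleftrightarrow> prob_space M \<and> (\<forall>n. X n \<in> measurable M (count_space UNIV))"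

abbreviation seq_space :: "(int \<Rightarrow> 'a) measure" where
  "seq_space \<equiv> PiM UNIV (\<lambda>_. count_space UNIV)"

definition stationary :: "'w measure \<Rightarrow> (int \<Rightarrow> 'w \<Rightarrow> 'a) \<Rightarrow> bool" where
  "stationary M X \<longleftrightarrow>
     (\<forall>h. distr M seq_space (\<lambda>\<omega> n. X (n + h) \<omega>) = distr M seq_space (\<lambda>\<omega> n. X n \<omega>))"

definition shift :: "(int \<Rightarrow> 'a) \<Rightarrow> int \<Rightarrow> 'a" where
  "shift x = (\<lambda>n. x (n + 1))"

definition ergodic :: "'w measure \<Rightarrow> (int \<Rightarrow> 'w \<Rightarrow> 'a) \<Rightarrow> bool" where
  "ergodic M X \<longleftrightarrow>
     (\<forall>A \<in> sets seq_space. shift -` A = A \<longrightarrow>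
        measure (distr M seq_space (\<lambda>\<omega> n. X n \<omega>)) A \<in> {0, 1})"

section \<open>Strings, Markov chains and their order\<close>

text \<open>Strings are lists, the oldest letter first. The string \<open>block x m n\<close> is empty if \<open>m > n\<close>.\<close>

definition block :: "(int \<Rightarrow> 'a) \<Rightarrow> int \<Rightarrow> int \<Rightarrow> 'a list" where
  "block x m n = map x [m..n]"

text \<open>A string of length \<open>L\<close> occupies the times \<open>1 - L, \<dots>, 0\<close>.\<close>

definition str_prob :: "'w measure \<Rightarrow> (int \<Rightarrow> 'w \<Rightarrow> 'a) \<Rightarrow> 'a list \<Rightarrow> real" where
  "str_prob M X z = \<P>(\<omega> in M. block (\<lambda>j. X j \<omega>) (1 - int (length z)) 0 = z)"

definition next_prob :: "'w measure \<Rightarrow> (int \<Rightarrow> 'w \<Rightarrow> 'a) \<Rightarrow> 'a \<Rightarrow> 'a list \<Rightarrow> real" where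
  "next_prob M X y z =
     \<P>(\<omega> in M. X 1 \<omega> = y \<bar> block (\<lambda>j. X j \<omega>) (1 - int (length z)) 0 = z)"

text \<open>For \<open>length z = K + i\<close>, the list \<open>drop i z\<close> is the suffix of length \<open>K\<close>.\<close>

definition markov_with :: "'w measure \<Rightarrow> (int \<Rightarrow> 'w \<Rightarrow> 'a) \<Rightarrow> nat \<Rightarrow> bool" where
  "markov_with M X K \<longleftrightarrow>
     (\<forall>y. \<forall>i\<ge>1. \<forall>z. length z = K + i \<and> str_prob M X z > 0 \<longrightarrow>
        next_prob M X y (drop i z) = next_prob M X y z)"

definition markov_chain :: "'w measure \<Rightarrow> (int \<Rightarrow> 'w \<Rightarrow> 'a) \<Rightarrow> bool" where
  "markov_chain M X \<longleftrightarrow> (\<exists>K. markov_with M X K)"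

definition markov_order :: "'w measure \<Rightarrow> (int \<Rightarrow> 'w \<Rightarrow> 'a) \<Rightarrow> nat" where
  "markov_order M X = (LEAST K. markov_with M X K)"

section \<open>The order estimator\<close>

text \<open>The functions below take a whole path \<open>x\<close>, but read only \<open>x 0, \<dots>, x n\<close>.\<close>

definition S1 :: "(int \<Rightarrow> 'a) \<Rightarrow> nat \<Rightarrow> nat \<Rightarrow> 'a list set" where
  "S1 x n k = {w. length w = k + 1 \<and>
     (\<exists>t. int k \<le> t \<and> t \<le> \<lceil>real n / 2\<rceil> - 1 \<and> block x (t - int k) t = w)}"

definition S2 :: "real \<Rightarrow> (int \<Rightarrow> 'a) \<Rightarrow> nat \<Rightarrow> nat \<Rightarrow> 'a list set" where
  "S2 \<gamma> x n k = {w. length w = k + 1 \<and>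
     real (card {t. \<lceil>real n / 2\<rceil> + int k \<le> t \<and> t \<le> int n \<and> block x (t - int k) t = w})
       > real n powr (1 - \<gamma>)}"

definition S :: "real \<Rightarrow> (int \<Rightarrow> 'a) \<Rightarrow> nat \<Rightarrow> nat \<Rightarrow> 'a list set" where
  "S \<gamma> x n k = S1 x n k \<inter> S2 \<gamma> x n k"

text \<open>\<open>emp_cond_prob x a z n1 n2\<close> is the empirical probability of the letter \<open>a\<close> after the
  string \<open>z\<close> in the samples \<open>x n1, \<dots>, x n2\<close>. Division by zero yields zero.\<close>

definition emp_cond_prob :: "(int \<Rightarrow> 'a) \<Rightarrow> 'a \<Rightarrow> 'a list \<Rightarrow> int \<Rightarrow> int \<Rightarrow> real" where
  "emp_cond_prob x a z n1 n2 =
     (let k = int (length z) in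
       real (card {t. n1 + k \<le> t \<and> t \<le> n2 \<and> block x (t - k) t = z @ [a]})
       / real (card {t. n1 + k - 1 \<le> t \<and> t \<le> n2 - 1 \<and> block x (t - k + 1) t = z}))"

definition Max0 :: "real set \<Rightarrow> real" where
  "Max0 A = (if A = {} then 0 else Max A)"

definition Delta_hat :: "real \<Rightarrow> (int \<Rightarrow> 'a) \<Rightarrow> nat \<Rightarrow> nat \<Rightarrow> real" where
  "Delta_hat \<gamma> x n k =
     Max0 ((\<lambda>i. Max0 {\<bar>emp_cond_prob x a (drop i z) \<lceil>real n / 2\<rceil> (int n)
                       - emp_cond_prob x a z \<lceil>real n / 2\<rceil> (int n)\<bar> | z a.
                       length z = k + i \<and> z @ [a] \<in> S \<gamma> x n (k + i)}) ` {1..n})"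

definition chi :: "real \<Rightarrow> real \<Rightarrow> (int \<Rightarrow> 'a) \<Rightarrow> nat \<Rightarrow> nat" where
  "chi \<gamma> \<beta> x n =
     (if n = 0 then 0 else (LEAST k. k < n \<and> Delta_hat \<gamma> x n k \<le> real n powr (- \<beta>)))"

text \<open>The maxima range over finite sets, and the minimum defining \<open>chi\<close> exists.\<close>

lemma finite_S: "finite (S \<gamma> x n k)"
proof -
  have "S1 x n k \<subseteq> (\<lambda>t. block x (t - int k) t) ` {int k..\<lceil>real n / 2\<rceil> - 1}"
    by (auto simp: S1_def)
  then have "finite (S1 x n k)" by (rule finite_subset) simp
  then show ?thesis by (simp add: S_def)
qed

lemma Delta_hat_last:
  assumes "n \<ge> 1"
  shows "Delta_hat \<gamma> x n (n - 1) = 0"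
proof -
  have *: "S \<gamma> x n (n - 1 + i) = {}" if "i \<in> {1..n}" for i
  proof -
    have "\<lceil>real n / 2\<rceil> \<le> int n" by linarith
    then show ?thesis using that assms by (auto simp: S_def S1_def)
  qed
  have "Delta_hat \<gamma> x n (n - 1) = Max0 ((\<lambda>i. 0) ` {1..n})"
    unfolding Delta_hat_def
    by (intro arg_cong[where f = Max0] image_cong refl) (simp only: * , simp add: Max0_def)
  then show ?thesis using assms by (simp add: Max0_def image_constant_conv)
qed

lemma chi_exists:
  assumes "n \<ge> 1"
  shows "\<exists>k. k < n \<and> Delta_hat \<gamma> x n k \<le> real n powr (- \<beta>)"
  using assms Delta_hat_last[OF assms, of \<gamma> x] by (intro exI[of _ "n - 1"]) simp

end

theory Submission
  imports Defs "HOL-Real_Asymp.Real_Asymp"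
begin

text \<open>
  If order \<open>k\<close> fails, some string \<open>z\<close> of positive probability and some letter \<open>a\<close> satisfy
  \<open>p(a|z) > p(a|z')\<close> for the suffix \<open>z'\<close> of \<open>z\<close> of length \<open>k\<close> (both distributions have total mass 1). By the
  ergodic theorem the string \<open>(z, a)\<close> is eventually frequent enough to be tested, and the empirical
  probabilities converge, so the statistic for \<open>k\<close> stays away from 0.

  If order \<open>K\<close> is correct, then given the first half of the sample, the centred number of
  occurrences of \<open>a\<close> after \<open>z\<close> in the second half is a martingale. An exponential supermartingale bounds
  deviations of relative size \<open>n\<^sup>-\<^sup>\<beta>\<close> over more than \<open>n\<^sup>1\<^sup>-\<^sup>\<gamma>\<close> visits by
  \<open>exp (- c n\<^sup>1\<^sup>-\<^sup>\<gamma>\<^sup>-\<^sup>2\<^sup>\<beta>)\<close>. Only the \<open>O(n\<^sup>2)\<close> strings seen in the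
  first half are tested, so Borel-Cantelli applies, although the alphabet may be infinite.
\<close>

section \<open>The ergodic theorem for indicator functions\<close>

text \<open>The Birkhoff sum of the indicator of \<open>B\<close> along the orbit of
  \<open>x\<close> under the time shift.\<close>

definition visits :: "(int \<Rightarrow> 'a) set \<Rightarrow> nat \<Rightarrow> (int \<Rightarrow> 'a) \<Rightarrow> real" where
  "visits B n x = (\<Sum>i<n. indicator B (\<lambda>j. x (j + int i)))"

lemma visits_nonneg: "0 \<le> visits B n x"
  by (auto simp: visits_def intro: sum_nonneg)

lemma visits_add: "visits B (m + n) x = visits B m x + visits B n (\<lambda>j. x (j + int m))"
  unfolding visits_def
  by (induction n) (simp_all add: ac_simps)

lemma visits_compl: "visits (- B) n x = real n - visits B n x"
proof -
  have "visits (- B) n x + visits B n x = (\<Sum>i<n. 1)"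
    unfolding visits_def sum.distrib[symmetric]
    by (intro sum.cong refl) (auto simp: indicator_def)
  then show ?thesis by simp
qed

section \<open>Blocks and shift invariance on path space\<close>

lemma block_shift: "block (\<lambda>j. x (j + h)) m n = block x (m + h) (n + h)"
proof -
  have "[m + h..n + h] = map (\<lambda>j. j + h) [m..n]"
    by (rule nth_equalityI) (auto simp: nth_upto)
  then show ?thesis by (simp add: block_def comp_def)
qed

lemma length_block [simp]: "length (block x m n) = nat (n - m + 1)"
  by (simp add: block_def)

lemma measurable_map_seq:
  "(\<lambda>x. map x js) \<in> measurable (seq_space :: (int \<Rightarrow> 'a::countable) measure) (count_space UNIV)"
proof -
  have "{x :: int \<Rightarrow> 'a. map x js = z} \<in> sets seq_space" for z
  proof (induction js arbitrary: z)
    case Nil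
    have "UNIV \<in> sets (seq_space :: (int \<Rightarrow> 'a) measure)"
      using sets.top[of "seq_space :: (int \<Rightarrow> 'a) measure"] by (simp add: space_PiM)
    then show ?case by (cases "z = []") auto
  next
    case (Cons j js)
    have j: "(\<lambda>x :: int \<Rightarrow> 'a. x j) \<in> measurable seq_space (count_space UNIV)"
      by (rule measurable_component_singleton) simp
    show ?case
    proof (cases z)
      case (Cons a z')
      have "{x :: int \<Rightarrow> 'a. map x (j # js) = z} = (\<lambda>x. x j) -` {a} \<inter> space seq_space \<inter> {x. map x js = z'}"
        by (auto simp: Cons space_PiM)
      then show ?thesis
        using measurable_sets[OF j, of "{a}"] Cons.IH[of z'] by (metis UNIV_I Pow_UNIV sets.Int sets_count_space)
    qed auto
  qed
  then show ?thesis
    by (subst measurable_count_space_eq2_countable) (auto simp: vimage_def space_PiM)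
qed

text \<open>The work is done on path space: \<open>Q\<close> is the law of the process, and
  \<open>stat\<close> says that time shifts preserve it. The given series is reduced to this case at
  the end.\<close>

locale stationary_law = prob_space Q
  for Q :: "(int \<Rightarrow> 'a::countable) measure" +
  assumes sets_Q [measurable_cong]: "sets Q = sets seq_space"
    and stat: "distr Q seq_space (\<lambda>x n. x (n + h)) = Q"
begin

lemma space_Q [simp]: "space Q = UNIV"
  using sets_eq_imp_space_eq[OF sets_Q] by (simp add: space_PiM)

lemma measurable_block: "(\<lambda>x. block x m n) \<in> measurable Q (count_space UNIV)"
  unfolding block_def using measurable_map_seq measurable_cong_sets[OF sets_Q refl] by blast

lemma measurable_of_block: "(\<lambda>x. f (block x m n)) \<in> measurable Q (count_space UNIV)"
  by (rule measurable_compose[OF measurable_block]) simp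

lemma sets_block: "{x. R (block x m n)} \<in> sets Q"
  using measurable_sets[OF measurable_block, of "{z. R z}" m n] by (simp add: vimage_def)

lemma measurable_shift: "(\<lambda>x n. x (n + h)) \<in> measurable Q Q"
proof -
  have "(\<lambda>x n. x (n + h)) \<in> measurable seq_space (seq_space :: (int \<Rightarrow> 'a) measure)"
    by (rule measurable_PiM_single') (auto simp: space_PiM intro: measurable_component_singleton)
  then show ?thesis using measurable_cong_sets[OF sets_Q sets_Q] by blast
qed

lemma prob_shift:
  assumes "{x. R x} \<in> sets Q"
  shows "prob {x. R (\<lambda>j. x (j + h))} = prob {x. R x}"
proof -
  have "prob {x. R x} = measure (distr Q seq_space (\<lambda>x n. x (n + h))) {x. R x}"
    by (simp add: stat)
  also have "\<dots> = prob ((\<lambda>x n. x (n + h)) -` {x. R x} \<inter> space Q)"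
    using assms measurable_shift[of h] sets_Q measurable_cong_sets[OF refl sets_Q]
    by (intro measure_distr) auto
  finally show ?thesis by (simp add: vimage_def)
qed

lemma prob_block_shift: "prob {x. R (block x (m + h) (n + h))} = prob {x. R (block x m n)}"
  using prob_shift[of "\<lambda>x. R (block x m n)" h] sets_block[of R m n] by (simp add: block_shift)

lemma measurable_visits [measurable]:
  assumes "B \<in> sets Q"
  shows "visits B n \<in> borel_measurable Q"
proof -
  have "(\<lambda>x. indicator B (\<lambda>j. x (j + int i)) :: real) \<in> borel_measurable Q" for i
    by (rule measurable_compose[OF measurable_shift borel_measurable_indicator[OF assms]])
  then show ?thesis unfolding visits_def by measurable
qed

lemma expectation_visits:
  assumes "B \<in> sets Q"
  shows "integrable Q (visits B n)" "expectation (visits B n) = real n * prob B"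
proof -
  have eq: "(\<lambda>x. indicator B (\<lambda>j. x (j + int i)) :: real) = indicator {x. (\<lambda>j. x (j + int i)) \<in> B}" for i
    by (auto simp: indicator_def)
  have s: "{x. (\<lambda>j. x (j + int i)) \<in> B} \<in> sets Q" for i
    using measurable_sets[OF measurable_shift[of "int i"] assms] by (simp add: vimage_def)
  have p: "prob {x. (\<lambda>j. x (j + int i)) \<in> B} = prob B" for i
    using prob_shift[of "\<lambda>x. x \<in> B" "int i"] assms by simp
  have i: "integrable Q (\<lambda>x. indicator B (\<lambda>j. x (j + int i)) :: real)" for i
    unfolding eq using s by (intro integrable_real_indicator) (auto simp: emeasure_eq_measure)
  show "integrable Q (visits B n)"
    unfolding visits_def using i by (intro Bochner_Integration.integrable_sum)
  have "expectation (visits B n) = (\<Sum>i<n. expectation (\<lambda>x. indicator B (\<lambda>j. x (j + int i))))"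
    unfolding visits_def using i by (intro Bochner_Integration.integral_sum)
  also have "\<dots> = real n * prob B"
    using s p by (simp add: eq)
  finally show "expectation (visits B n) = real n * prob B" .
qed

text \<open>The covering argument of Katznelson and Weiss: up to the small exceptional set \<open>D L\<close>, every
  orbit segment splits into pieces of length at most \<open>L\<close> with visiting frequency at least \<open>a\<close>.\<close>

lemma visit_density_le_prob:
  assumes B: "B \<in> sets Q" and ex: "AE x in Q. \<exists>n\<ge>1. visits B n x \<ge> a * real n"
  shows "a \<le> prob B"
proof (cases "a \<le> 0")
  case True
  then show ?thesis using measure_nonneg[of Q B] by linarith
next
  case False
  then have a: "a > 0" by simp
  \<comment> \<open>Points that start no good piece of length at most \<open>L\<close>. These sets
    decrease in \<open>L\<close>, and their intersection is null by \<open>ex\<close>.\<close>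
  define D where "D L = {x. \<not> (\<exists>n\<in>{1..L}. visits B n x \<ge> a * real n)}" for L
  have D: "D L \<in> sets Q" for L
  proof -
    have "{x \<in> space Q. \<not> (\<exists>n\<in>{1..L}. visits B n x \<ge> a * real n)} \<in> sets Q"
      using B by measurable
    then show ?thesis by (simp add: D_def)
  qed
  \<comment> \<open>Strong induction, cutting off the first piece: a point of \<open>D L\<close>
    forms a piece of length 1, paid for by its visit to \<open>D L\<close>; any other point starts a
    piece of length \<open>m\<close> with at least \<open>a * m\<close> visits to \<open>B\<close>.
    The term \<open>a * L\<close> pays for the final stretch of length at most
    \<open>L\<close>.\<close>
  have cover: "visits B n x + a * visits (D L) n x \<ge> a * (real n - real L)" if "L \<ge> 1" for n x L
  proof (induction n arbitrary: x rule: less_induct)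
    case (less n)
    show ?case
    proof (cases "n \<le> L")
      case True
      then have "a * (real n - real L) \<le> 0" using a by (simp add: mult_le_0_iff)
      then show ?thesis using visits_nonneg[of B n x] visits_nonneg[of "D L" n x] a
        by (smt (verit) mult_nonneg_nonneg)
    next
      case False
      have "\<exists>m\<in>{1..L}. visits B m x + a * visits (D L) m x \<ge> a * real m"
      proof (cases "x \<in> D L")
        case True
        then have "visits (D L) 1 x = 1" by (simp add: visits_def)
        then have "visits B 1 x + a * visits (D L) 1 x \<ge> a * real 1"
          using visits_nonneg[of B 1 x] by simp
        then show ?thesis using that by (intro bexI[of _ 1]) auto
      next
        case False
        then obtain m where "m \<in> {1..L}" "visits B m x \<ge> a * real m" by (auto simp: D_def)
        then show ?thesis using visits_nonneg[of "D L" m x] a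
          by (intro bexI[of _ m]) (smt (verit) mult_nonneg_nonneg)+
      qed
      then obtain m where m: "m \<in> {1..L}" and "visits B m x + a * visits (D L) m x \<ge> a * real m"
        by blast
      moreover define y where "y = (\<lambda>j. x (j + int m))"
      have "visits B (n - m) y + a * visits (D L) (n - m) y \<ge> a * (real (n - m) - real L)"
        using m False by (intro less.IH) auto
      moreover have "visits C n x = visits C m x + visits C (n - m) y" for C
        using visits_add[of C m "n - m" x] m False by (simp add: y_def)
      moreover have "a * (real n - real L) = a * real m + a * (real (n - m) - real L)"
        using m False by (simp add: algebra_simps of_nat_diff)
      ultimately show ?thesis by (simp add: algebra_simps)
    qed
  qed
  have le: "a \<le> prob B + a * prob (D L)" if L: "L \<ge> 1" for L
  proof (rule ccontr)
    define d where "d = a - (prob B + a * prob (D L))"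
    assume "\<not> ?thesis"
    then have d: "d > 0" by (simp add: d_def)
    \<comment> \<open>Integrating \<open>cover\<close> gives this for every \<open>n\<close>, while
      the left side is unbounded because \<open>d > 0\<close>.\<close>
    have "real n * d \<le> a * real L" for n
    proof -
      have "a * (real n - real L) \<le> expectation (\<lambda>x. visits B n x + a * visits (D L) n x)"
        using expectation_visits(1)[OF B, of n] expectation_visits(1)[OF D, of L n] cover[OF L, of n]
        by (intro integral_ge_const) auto
      also have "\<dots> = real n * prob B + a * (real n * prob (D L))"
        using expectation_visits[OF B, of n] expectation_visits[OF D, of L n] by simp
      finally show ?thesis by (simp add: d_def algebra_simps)
    qed
    moreover obtain n :: nat where "real n * d > a * real L"
      using reals_Archimedean3[OF d] by blast
    ultimately show False by (meson not_le)
  qed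
  have "AE x in Q. x \<notin> (\<Inter>L. D L)"
    using ex
  proof eventually_elim
    case (elim x)
    then obtain n where "n \<ge> 1" "visits B n x \<ge> a * real n" by blast
    then have "x \<notin> D n" by (auto simp: D_def)
    then show ?case by blast
  qed
  then have "prob (\<Inter>L. D L) = 0"
    using D by (subst prob_eq_0) (auto intro!: sets.countable_INT)
  moreover have "(\<lambda>L. prob (D L)) \<longlonglongrightarrow> prob (\<Inter>L. D L)"
    using D by (intro finite_Lim_measure_decseq) (auto simp: decseq_def D_def)
  ultimately have "(\<lambda>L. prob B + a * prob (D L)) \<longlonglongrightarrow> prob B + a * 0"
    by (intro tendsto_intros) simp
  then show ?thesis
    using le by (intro LIMSEQ_le_const[of _ "prob B" a]) auto
qed

end

section \<open>Almost sure visiting frequencies under ergodicity\<close>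

locale ergodic_law = stationary_law +
  assumes erg: "A \<in> sets Q \<Longrightarrow> shift -` A = A \<Longrightarrow> prob A \<in> {0, 1}"
begin

text \<open>If the visits outran every linear bound of slope \<open>a\<close> with positive
  probability, they would do so almost surely by ergodicity. Almost every orbit would then have a
  segment of density at least \<open>a\<close>, contrary to
  \<open>visit_density_le_prob\<close>.\<close>

lemma visits_le_linear:
  assumes B: "B \<in> sets Q" and a: "prob B < a"
  shows "AE x in Q. \<exists>C::nat. \<forall>n. visits B n x \<le> a * real n + real C"
proof -
  \<comment> \<open>Unlike the event that the limit superior of the frequencies exceeds \<open>a\<close>, this event is
    trivially shift invariant.\<close>
  define E where "E = {x. \<forall>C::nat. \<exists>n. visits B n x > a * real n + real C}"
  have "{x \<in> space Q. \<forall>C::nat. \<exists>n. visits B n x > a * real n + real C} \<in> sets Q"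
    using B by measurable
  then have E: "E \<in> sets Q" by (simp add: E_def)
  have step: "visits B (Suc n) x = indicator B x + visits B n (shift x)" for n x
    using visits_add[of B 1 n x] by (simp add: visits_def shift_def)
  \<comment> \<open>The shift removes at most one visit and one unit of \<open>n\<close>, a change
    of at most \<open>k\<close>, which the quantifier over all \<open>C\<close> absorbs.\<close>
  obtain k :: nat where k: "real k \<ge> \<bar>a\<bar> + 1" using real_arch_simple by blast
  have "shift x \<in> E \<longleftrightarrow> x \<in> E" for x
  proof
    assume x: "x \<in> E"
    show "shift x \<in> E" unfolding E_def
    proof (intro CollectI allI)
      fix C :: nat
      obtain n where n: "visits B n x > a * real n + real (C + k)" using x unfolding E_def by blast
      then obtain m where m: "n = Suc m" by (cases n) (auto simp: visits_def)
      have ib: "indicator B x \<le> (1::real)" by simp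
      have "visits B m (shift x) > a * real m + real C"
        using n k ib unfolding m step of_nat_Suc of_nat_add distrib_left by linarith
      then show "\<exists>n. visits B n (shift x) > a * real n + real C" by blast
    qed
  next
    assume x: "shift x \<in> E"
    show "x \<in> E" unfolding E_def
    proof (intro CollectI allI)
      fix C :: nat
      obtain n where "visits B n (shift x) > a * real n + real (C + k)" using x unfolding E_def by blast
      then have "visits B (Suc n) x > a * real (Suc n) + real C"
        using k unfolding step by (auto simp: algebra_simps indicator_def split: if_splits)
      then show "\<exists>n. visits B n x > a * real n + real C" by blast
    qed
  qed
  then have "shift -` E = E" by auto
  then consider "prob E = 0" | "prob E = 1" using erg[OF E] by auto
  then show ?thesis
  proof cases
    case 1
    then have "AE x in Q. x \<notin> E" using E prob_eq_0 by blast
    then show ?thesis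
    proof eventually_elim
      case (elim x)
      then show ?case unfolding E_def by (auto simp: not_less)
    qed
  next
    case 2
    then have "AE x in Q. x \<in> E" using E prob_eq_1 by blast
    then have "AE x in Q. \<exists>n\<ge>1. visits B n x \<ge> a * real n"
    proof eventually_elim
      case (elim x)
      then obtain n where n: "visits B n x > a * real n + real 0" unfolding E_def by blast
      then have "n \<noteq> 0" by (auto simp: visits_def intro: ccontr)
      then show ?case using n by (intro exI[of _ n]) auto
    qed
    then have "a \<le> prob B" by (rule visit_density_le_prob[OF B])
    then show ?thesis using a by simp
  qed
qed

text \<open>\<open>visits_le_linear\<close> bounds the frequency from above at every level over
  \<open>prob B\<close>; applied to the complement it bounds it from below. The levels
  \<open>prob B + e m\<close> leave only countably many null sets.\<close>

lemma visits_tendsto: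
  assumes B: "B \<in> sets Q"
  shows "AE x in Q. (\<lambda>n. visits B n x / real n) \<longlonglongrightarrow> prob B"
proof -
  define e where "e m = 1 / real (Suc m)" for m
  have e: "e m > 0" for m by (simp add: e_def)
  have B': "- B \<in> sets Q" using sets.compl_sets[OF B] by (simp add: Compl_eq_Diff_UNIV)
  have pB': "prob (- B) = 1 - prob B" using prob_compl[OF B] by (simp add: Compl_eq_Diff_UNIV)
  have "AE x in Q. \<forall>m. \<exists>C::nat. \<forall>n. visits B n x \<le> (prob B + e m) * real n + real C"
    unfolding AE_all_countable using e by (intro allI visits_le_linear[OF B]) simp
  moreover have "AE x in Q. \<forall>m. \<exists>C::nat. \<forall>n. visits (- B) n x \<le> (prob (- B) + e m) * real n + real C"
    unfolding AE_all_countable using e by (intro allI visits_le_linear[OF B']) simp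
  ultimately show ?thesis
  proof eventually_elim
    case (elim x)
    show ?case
    proof (rule LIMSEQ_I)
      fix r :: real assume r: "r > 0"
      obtain m where m: "e m < r / 2" unfolding e_def
        using r nat_approx_posE[of "r / 2"] by auto
      obtain C1 C2 :: nat where
        C1: "\<And>n. visits B n x \<le> (prob B + e m) * real n + real C1" and
        C2: "\<And>n. visits (- B) n x \<le> (prob (- B) + e m) * real n + real C2"
        using elim by metis
      obtain N :: nat where N: "real N > 2 * (real C1 + real C2) / r" using reals_Archimedean2 by blast
      show "\<exists>N. \<forall>n\<ge>N. norm (visits B n x / real n - prob B) < r"
      proof (intro exI[of _ "Suc N"] allI impI)
        fix n assume n: "n \<ge> Suc N"
        then have n0: "real n > 0" by simp
        have "real n > 2 * (real C1 + real C2) / r" using N n by linarith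
        then have c: "real C1 + real C2 < r / 2 * real n" using r by (simp add: field_simps)
        have em: "e m * real n < r / 2 * real n" using m n0 by simp
        have "visits B n x \<le> prob B * real n + e m * real n + real C1"
          using C1[of n] by (simp add: algebra_simps)
        moreover have "visits B n x \<ge> prob B * real n - e m * real n - real C2"
          using C2[of n] unfolding visits_compl pB' by (simp add: algebra_simps)
        ultimately have "\<bar>visits B n x - prob B * real n\<bar> < r * real n"
          using c em by (simp add: abs_less_iff)
        moreover have "visits B n x / real n - prob B = (visits B n x - prob B * real n) / real n"
          using n0 by (simp add: field_simps)
        ultimately show "norm (visits B n x / real n - prob B) < r"
          using n0 by (simp add: abs_divide divide_less_eq)
      qed
    qed
  qed
qed

end

section \<open>Underestimation\<close>

text \<open>\<open>t\<close> is the time of the last letter, and only occurrences lying wholly in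
  \<open>{n1..n2}\<close> count. The numerator and the denominator of \<open>emp_cond_prob\<close>
  are both of this form.\<close>

definition occ :: "(int \<Rightarrow> 'a) \<Rightarrow> 'a list \<Rightarrow> int \<Rightarrow> int \<Rightarrow> nat" where
  "occ x w n1 n2 = card {t. n1 + int (length w) - 1 \<le> t \<and> t \<le> n2 \<and> block x (t - int (length w) + 1) t = w}"

lemma emp_cond_prob_occ:
  "emp_cond_prob x a z n1 n2 = real (occ x (z @ [a]) n1 n2) / real (occ x z n1 (n2 - 1))"
  by (simp add: emp_cond_prob_def occ_def Let_def algebra_simps)

lemma S2_occ:
  "w \<in> S2 \<gamma> x n k \<longleftrightarrow> length w = k + 1 \<and> real n powr (1 - \<gamma>) < real (occ x w \<lceil>real n / 2\<rceil> (int n))"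
  by (auto simp: S2_def occ_def algebra_simps)

text \<open>\<open>occ\<close> locates an occurrence by its last time, \<open>visits\<close> by its
  first. First times below \<open>b\<close> correspond to last times up to
  \<open>b + length w - 2\<close>.\<close>

lemma occ_eq_visits:
  assumes "a \<le> b"
  shows "real (occ x w (int a) (int b + int (length w) - 2)) =
    visits {x. block x 0 (int (length w) - 1) = w} b x - visits {x. block x 0 (int (length w) - 1) = w} a x"
proof -
  define L where "L = int (length w)"
  define B where "B = {x. block x 0 (L - 1) = w}"
  have "bij_betw (\<lambda>i. int a + int i + L - 1) {i. i < b - a \<and> (\<lambda>j. x (j + int a + int i)) \<in> B}
     {t. int a + L - 1 \<le> t \<and> t \<le> int b + L - 2 \<and> block x (t - L + 1) t = w}"
  proof (rule bij_betw_byWitness[where f' = "\<lambda>t. nat (t - int a - L + 1)"])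
    have *: "(\<lambda>j. x (j + int a + int i)) \<in> B \<longleftrightarrow> block x (int a + int i) (int a + int i + L - 1) = w" for i
      using block_shift[of x "int a + int i" 0 "L - 1"] by (simp add: B_def algebra_simps)
    show "(\<lambda>i. int a + int i + L - 1) ` {i. i < b - a \<and> (\<lambda>j. x (j + int a + int i)) \<in> B}
      \<subseteq> {t. int a + L - 1 \<le> t \<and> t \<le> int b + L - 2 \<and> block x (t - L + 1) t = w}"
      unfolding * by auto
    show "(\<lambda>t. nat (t - int a - L + 1)) ` {t. int a + L - 1 \<le> t \<and> t \<le> int b + L - 2 \<and> block x (t - L + 1) t = w}
      \<subseteq> {i. i < b - a \<and> (\<lambda>j. x (j + int a + int i)) \<in> B}"
    proof (intro subsetI)
      fix i assume "i \<in> (\<lambda>t. nat (t - int a - L + 1)) ` {t. int a + L - 1 \<le> t \<and> t \<le> int b + L - 2 \<and> block x (t - L + 1) t = w}"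
      then obtain t where t: "int a + L - 1 \<le> t" "t \<le> int b + L - 2" "block x (t - L + 1) t = w"
        and i: "i = nat (t - int a - L + 1)" by blast
      have 1: "int a + int i = t - L + 1" using t i by simp
      then have 2: "int a + int i + L - 1 = t" and "i < b - a" using t by simp_all
      then show "i \<in> {i. i < b - a \<and> (\<lambda>j. x (j + int a + int i)) \<in> B}"
        unfolding * mem_Collect_eq 2 unfolding 1 using t by blast
    qed
  qed auto
  then have "occ x w (int a) (int b + int (length w) - 2) = card {i. i < b - a \<and> (\<lambda>j. x (j + int a + int i)) \<in> B}"
    unfolding occ_def L_def[symmetric] by (rule bij_betw_same_card[symmetric])
  also have "real \<dots> = visits B (b - a) (\<lambda>j. x (j + int a))"
    unfolding visits_def indicator_def of_bool_def by (simp add: sum.If_cases Int_def ac_simps)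
  also have "\<dots> = visits B b x - visits B a x"
    using visits_add[of B a "b - a" x] assms by simp
  finally show ?thesis by (simp add: B_def L_def)
qed

lemma block_snoc: "m \<le> n + 1 \<Longrightarrow> block x m (n + 1) = block x m n @ [x (n + 1)]"
  by (simp add: block_def upto_rec2)

lemma Max0_ge: "finite A \<Longrightarrow> a \<in> A \<Longrightarrow> a \<le> Max0 A"
  by (auto simp: Max0_def)

lemma Max0_le: "finite A \<Longrightarrow> 0 \<le> c \<Longrightarrow> (\<And>a. a \<in> A \<Longrightarrow> a \<le> c) \<Longrightarrow> Max0 A \<le> c"
  by (auto simp: Max0_def)

lemma finite_deviations:
  "finite {f z a | z a. length z = k + i \<and> z @ [a] \<in> S \<gamma> x n (k + i)}"
proof -
  have "{f z a | z a. length z = k + i \<and> z @ [a] \<in> S \<gamma> x n (k + i)}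
    \<subseteq> (\<lambda>w. f (butlast w) (last w)) ` S \<gamma> x n (k + i)"
    by (auto intro!: image_eqI)
  then show ?thesis using finite_S finite_surj by blast
qed

lemma Delta_hat_ge:
  assumes "1 \<le> i" "i \<le> n" "length z = k + i" "z @ [a] \<in> S \<gamma> x n (k + i)"
  shows "\<bar>emp_cond_prob x a (drop i z) \<lceil>real n / 2\<rceil> (int n) - emp_cond_prob x a z \<lceil>real n / 2\<rceil> (int n)\<bar>
    \<le> Delta_hat \<gamma> x n k"
proof -
  have "\<bar>emp_cond_prob x a (drop i z) \<lceil>real n / 2\<rceil> (int n) - emp_cond_prob x a z \<lceil>real n / 2\<rceil> (int n)\<bar>
    \<le> Max0 {\<bar>emp_cond_prob x a (drop i z) \<lceil>real n / 2\<rceil> (int n)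
             - emp_cond_prob x a z \<lceil>real n / 2\<rceil> (int n)\<bar> | z a.
             length z = k + i \<and> z @ [a] \<in> S \<gamma> x n (k + i)}"
    using assms by (intro Max0_ge finite_deviations) auto
  also have "\<dots> \<le> Delta_hat \<gamma> x n k"
    unfolding Delta_hat_def using assms by (intro Max0_ge) auto
  finally show ?thesis .
qed

lemma Delta_hat_le:
  assumes "0 \<le> c"
    and "\<And>i z a. 1 \<le> i \<Longrightarrow> length z = k + i \<Longrightarrow> z @ [a] \<in> S \<gamma> x n (k + i) \<Longrightarrow>
      \<bar>emp_cond_prob x a (drop i z) \<lceil>real n / 2\<rceil> (int n) - emp_cond_prob x a z \<lceil>real n / 2\<rceil> (int n)\<bar> \<le> c"
  shows "Delta_hat \<gamma> x n k \<le> c"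
  unfolding Delta_hat_def
  using assms by (intro Max0_le finite_imageI finite_atLeastAtMost assms(1))
    (auto intro!: Max0_le finite_deviations)

lemma tendsto_subsample:
  fixes f :: "nat \<Rightarrow> real"
  assumes f: "(\<lambda>m. f m / real m) \<longlonglongrightarrow> p" and b: "filterlim b at_top sequentially"
    and c: "(\<lambda>n. real (b n) / real n) \<longlonglongrightarrow> c"
  shows "(\<lambda>n. f (b n) / real n) \<longlonglongrightarrow> p * c"
proof (rule Lim_transform_eventually)
  show "(\<lambda>n. (f (b n) / real (b n)) * (real (b n) / real n)) \<longlonglongrightarrow> p * c"
    by (intro tendsto_mult c filterlim_compose[OF f b])
  have "eventually (\<lambda>n. b n > 0) sequentially"
    using b eventually_gt_at_top[of 0] by (rule eventually_compose_filterlim[rotated])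
  then show "eventually (\<lambda>n. (f (b n) / real (b n)) * (real (b n) / real n) = f (b n) / real n) sequentially"
    by eventually_elim simp
qed

section \<open>String and next-letter probabilities\<close>

context stationary_law
begin

abbreviation Pr :: "'a list \<Rightarrow> real" where
  "Pr \<equiv> str_prob Q (\<lambda>j x. x j)"

abbreviation Nx :: "'a \<Rightarrow> 'a list \<Rightarrow> real" where
  "Nx \<equiv> next_prob Q (\<lambda>j x. x j)"

lemma prob_block_eq: "prob {x. block x (t - int (length w) + 1) t = w} = Pr w"
  using prob_block_shift[of "\<lambda>v. v = w" "1 - int (length w)" t 0]
  by (simp add: str_prob_def algebra_simps)

lemma Nx_eq: "Nx y z = Pr (z @ [y]) / Pr z"
proof -
  have "block x (1 - int (length z)) 1 = block x (1 - int (length z)) 0 @ [x 1]" for x :: "int \<Rightarrow> 'a"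
    using block_snoc[of "1 - int (length z)" 0 x] by simp
  then have "(x 1 = y \<and> block x (1 - int (length z)) 0 = z) = (block x (1 - int (length z)) 1 = z @ [y])"
    for x :: "int \<Rightarrow> 'a"
    by (metis append1_eq_conv)
  then have "{x. x 1 = y \<and> block x (1 - int (length z)) 0 = z}
     = {x. block x (1 - int (length (z @ [y])) + 1) 1 = z @ [y]}"
    by auto
  then show ?thesis
    using prob_block_eq[of 1 "z @ [y]"]
    by (simp add: next_prob_def cond_prob_def str_prob_def[of _ _ z])
qed

lemma Pr_nonneg: "0 \<le> Pr w"
  by (simp add: str_prob_def)

text \<open>Both next-letter laws are probability mass functions, and two different ones cannot be
  ordered pointwise. The direction matters: it makes \<open>Nx a v\<close> positive, so that
  \<open>v @ [a]\<close> has positive probability and is eventually tested.\<close>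

lemma exists_greater_next_prob:
  assumes u: "Pr u > 0" and v: "Pr v > 0" and ne: "Nx y u \<noteq> Nx y v"
  shows "\<exists>a. Nx a u < Nx a v"
proof -
  have "\<exists>p. \<forall>a. pmf p a = Nx a z" if z: "Pr z > 0" for z
  proof -
    define E where "E = {x. block x (1 - int (length z)) 0 = z}"
    have E: "E \<in> sets Q" unfolding E_def by (rule sets_block)
    have PE: "prob E = Pr z" by (simp add: E_def str_prob_def)
    define U where "U = uniform_measure Q E"
    interpret U: prob_space U
      unfolding U_def using PE z by (intro prob_space_uniform_measure) (auto simp: emeasure_eq_measure)
    have m: "(\<lambda>x. x 1) \<in> measurable U (count_space UNIV)"
    proof -
      have "(\<lambda>x. hd (block x 1 1)) \<in> measurable Q (count_space UNIV)" by (rule measurable_of_block)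
      then have "(\<lambda>x. x 1) \<in> measurable Q (count_space UNIV)" by (simp add: block_def)
      then show ?thesis unfolding U_def by simp
    qed
    define D where "D = distr U (count_space UNIV) (\<lambda>x. x 1)"
    interpret D: prob_space D unfolding D_def by (rule U.prob_space_distr[OF m])
    have sets_D: "sets D = UNIV" by (simp add: D_def)
    have "AE a in D. measure D {a} \<noteq> 0"
      by (subst D.AE_support_countable[OF sets_D]) (auto intro!: exI[of _ UNIV])
    then have "pmf (Abs_pmf D) a = measure D {a}" for a
      using sets_D D.prob_space_axioms by (subst pmf.rep_eq, subst Abs_pmf_inverse) auto
    moreover have "measure D {a} = Nx a z" for a
    proof -
      have s: "{x. x 1 = a} \<in> sets Q"
        using sets_block[of "\<lambda>v. v = [a]" 1 1] by (simp add: block_def)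
      have "measure D {a} = measure U {x. x 1 = a}"
        unfolding D_def by (subst measure_distr[OF m]) (auto simp: U_def vimage_def)
      also have "\<dots> = prob (E \<inter> {x. x 1 = a}) / prob E"
        unfolding U_def by (rule measure_uniform_measure[OF _ _ s]) (use PE z in \<open>auto simp: emeasure_eq_measure\<close>)
      also have "E \<inter> {x. x 1 = a} = {x. x 1 = a \<and> block x (1 - int (length z)) 0 = z}"
        by (auto simp: E_def)
      finally show ?thesis
        by (simp add: next_prob_def cond_prob_def E_def)
    qed
    ultimately show ?thesis by auto
  qed
  then obtain p q where p: "\<And>a. pmf p a = Nx a u" and q: "\<And>a. pmf q a = Nx a v"
    using u v by metis
  have "p \<noteq> q" using p q ne by metis
  from pmf_neq_exists_less[OF this] show ?thesis using p q by auto
qed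

lemma Pr_suffix: "Pr z \<le> Pr (drop i z)"
proof (cases "i \<le> length z")
  case True
  have *: "block x (1 - int (length (drop i z))) 0 = drop i (block x (1 - int (length z)) 0)" for x :: "int \<Rightarrow> 'a"
    using True by (intro nth_equalityI) (auto simp: block_def nth_upto algebra_simps)
  have "Pr z = prob {x. block x (1 - int (length z)) 0 = z}" by (simp add: str_prob_def)
  also have "\<dots> \<le> prob {x. block x (1 - int (length (drop i z))) 0 = drop i z}"
  proof (intro finite_measure_mono sets_block subsetI)
    fix x assume "x \<in> {x. block x (1 - int (length z)) 0 = z}"
    then have "drop i (block x (1 - int (length z)) 0) = drop i z" by simp
    then have "block x (1 - int (length (drop i z))) 0 = drop i z" by (simp only: *)
    then show "x \<in> {x. block x (1 - int (length (drop i z))) 0 = drop i z}" by simp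
  qed
  also have "\<dots> = Pr (drop i z)" by (simp add: str_prob_def)
  finally show ?thesis .
next
  case False
  then have "Pr (drop i z) = 1"
    by (simp add: str_prob_def block_def prob_space[simplified])
  then show ?thesis by (simp add: str_prob_def)
qed

end

section \<open>Almost sure limits of the empirical quantities\<close>

context ergodic_law
begin

text \<open>The window is the difference of two initial segments whose lengths grow like
  \<open>n\<close> and \<open>n / 2\<close>, whence the factor 1/2. The offset \<open>e\<close> is 0
  for the numerator and 1 for the denominator of \<open>emp_cond_prob\<close>.\<close>

lemma occ_tendsto:
  "AE x in Q. (\<lambda>n. real (occ x w \<lceil>real n / 2\<rceil> (int n - int e)) / real n) \<longlonglongrightarrow> Pr w / 2"
proof -
  define B where "B = {x :: int \<Rightarrow> 'a. block x 0 (int (length w) - 1) = w}"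
  have B: "B \<in> sets Q" unfolding B_def by (rule sets_block)
  have pB: "prob B = Pr w"
    unfolding B_def using prob_block_eq[of "int (length w) - 1" w] by simp
  define a where "a n = nat \<lceil>real n / 2\<rceil>" for n :: nat
  \<comment> \<open>The number of starting times from 0 on for which an occurrence ends by time
    \<open>n - e\<close>; the subtraction truncates only for small \<open>n\<close>.\<close>
  define b where "b n = n + 2 - length w - e" for n :: nat
  have a1: "(\<lambda>n. real (a n) / real n) \<longlonglongrightarrow> 1 / 2"
  proof (rule real_tendsto_sandwich)
    show "eventually (\<lambda>n. 1 / 2 \<le> real (a n) / real n) sequentially"
      using eventually_gt_at_top[of 0]
    proof eventually_elim
      case (elim n)
      have "real n / 2 \<le> real (a n)" unfolding a_def by linarith
      then show ?case using elim by (simp add: field_simps)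
    qed
    show "eventually (\<lambda>n. real (a n) / real n \<le> 1 / 2 + 1 / real n) sequentially"
      using eventually_gt_at_top[of 0]
    proof eventually_elim
      case (elim n)
      have "real (a n) \<le> real n / 2 + 1" unfolding a_def by linarith
      then show ?case using elim by (simp add: field_simps)
    qed
    show "(\<lambda>n. 1 / 2 + 1 / real n) \<longlonglongrightarrow> 1 / 2"
      using tendsto_add[OF tendsto_const lim_1_over_n, of "1 / 2 :: real"] by simp
  qed simp
  have b1: "(\<lambda>n. real (b n) / real n) \<longlonglongrightarrow> 1"
  proof (rule Lim_transform_eventually)
    have "(\<lambda>n. 1 + (2 - real (length w) - real e) * (1 / real n)) \<longlonglongrightarrow> 1 + (2 - real (length w) - real e) * 0"
      by (intro tendsto_intros lim_1_over_n)
    then show "(\<lambda>n. 1 + (2 - real (length w) - real e) * (1 / real n)) \<longlonglongrightarrow> 1" by simp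
    show "eventually (\<lambda>n. 1 + (2 - real (length w) - real e) * (1 / real n) = real (b n) / real n) sequentially"
      using eventually_gt_at_top[of "length w + e"]
      by eventually_elim (auto simp: b_def of_nat_diff field_simps)
  qed
  have a2: "filterlim a at_top sequentially" and b2: "filterlim b at_top sequentially"
    unfolding filterlim_at_top
  proof -
    show "\<forall>Z. eventually (\<lambda>n. Z \<le> a n) sequentially"
    proof
      fix Z show "eventually (\<lambda>n. Z \<le> a n) sequentially"
        using eventually_ge_at_top[of "2 * Z"] by eventually_elim (unfold a_def, linarith)
    qed
    show "\<forall>Z. eventually (\<lambda>n. Z \<le> b n) sequentially"
    proof
      fix Z show "eventually (\<lambda>n. Z \<le> b n) sequentially"
        using eventually_ge_at_top[of "Z + length w + e"] by eventually_elim (simp add: b_def)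
    qed
  qed
  from visits_tendsto[OF B] show ?thesis
  proof eventually_elim
    case (elim x)
    have "(\<lambda>n. visits B (b n) x / real n - visits B (a n) x / real n) \<longlonglongrightarrow> prob B * 1 - prob B * (1 / 2)"
      by (intro tendsto_diff tendsto_subsample[of "\<lambda>n. visits B n x"] elim a1 a2 b1 b2)
    then have lim: "(\<lambda>n. visits B (b n) x / real n - visits B (a n) x / real n) \<longlonglongrightarrow> Pr w / 2"
      by (simp add: pB)
    show ?case
    proof (rule Lim_transform_eventually[OF lim])
      show "eventually (\<lambda>n. visits B (b n) x / real n - visits B (a n) x / real n
          = real (occ x w \<lceil>real n / 2\<rceil> (int n - int e)) / real n) sequentially"
        using eventually_ge_at_top[of "2 * (length w + e) + 2"]
      proof eventually_elim
        case (elim n)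
        have "\<lceil>real n / 2\<rceil> \<le> int n + 2 - int (length w) - int e"
        proof (rule ceiling_le)
          have "real (2 * (length w + e) + 2) \<le> real n" using elim by (simp only: of_nat_le_iff)
          then show "real n / 2 \<le> of_int (int n + 2 - int (length w) - int e)" by simp
        qed
        then have "a n \<le> b n" using elim unfolding a_def b_def by simp
        moreover have "int (a n) = \<lceil>real n / 2\<rceil>" unfolding a_def by simp
        moreover have "int (b n) + int (length w) - 2 = int n - int e"
          using elim by (auto simp: b_def of_nat_diff)
        ultimately show ?case
          using occ_eq_visits[of "a n" "b n" x w] by (simp add: B_def diff_divide_distrib)
      qed
    qed
  qed
qed

lemma emp_cond_prob_tendsto:
  assumes "Pr z > 0"
  shows "AE x in Q. (\<lambda>n. emp_cond_prob x a z \<lceil>real n / 2\<rceil> (int n)) \<longlonglongrightarrow> Nx a z"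
  using occ_tendsto[of "z @ [a]" 0] occ_tendsto[of z 1]
proof eventually_elim
  case (elim x)
  have "(\<lambda>n. (real (occ x (z @ [a]) \<lceil>real n / 2\<rceil> (int n)) / real n)
      / (real (occ x z \<lceil>real n / 2\<rceil> (int n - 1)) / real n)) \<longlonglongrightarrow> (Pr (z @ [a]) / 2) / (Pr z / 2)"
    using elim assms by (intro tendsto_divide[of _ "Pr (z @ [a]) / 2" _ _ "Pr z / 2"]) auto
  then have "(\<lambda>n. (real (occ x (z @ [a]) \<lceil>real n / 2\<rceil> (int n)) / real n)
      / (real (occ x z \<lceil>real n / 2\<rceil> (int n - 1)) / real n)) \<longlonglongrightarrow> Nx a z"
    by (simp add: Nx_eq)
  then show ?case
  proof (rule Lim_transform_eventually)
    show "eventually (\<lambda>n. (real (occ x (z @ [a]) \<lceil>real n / 2\<rceil> (int n)) / real n)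
      / (real (occ x z \<lceil>real n / 2\<rceil> (int n - 1)) / real n)
      = emp_cond_prob x a z \<lceil>real n / 2\<rceil> (int n)) sequentially"
      using eventually_gt_at_top[of 0] by eventually_elim (simp add: emp_cond_prob_occ)
  qed
qed

text \<open>Positive frequency provides an occurrence of \<open>w\<close>, which keeps
  \<open>w\<close> in \<open>S1\<close> once the growing first half contains it. Membership in
  \<open>S2\<close> follows because the count in the second half is of order \<open>n\<close>, above
  \<open>real n powr (1 - \<gamma>)\<close>.\<close>

lemma eventually_in_S:
  assumes "0 < \<gamma>" and w: "Pr w > 0" and len: "length w = k + 1"
  shows "AE x in Q. eventually (\<lambda>n. w \<in> S \<gamma> x n k) sequentially"
proof -
  define B where "B = {x :: int \<Rightarrow> 'a. block x 0 (int k) = w}"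
  have B: "B \<in> sets Q" unfolding B_def by (rule sets_block)
  have pB: "prob B > 0"
    unfolding B_def using prob_block_eq[of "int k" w] w len by simp
  show ?thesis
    using visits_tendsto[OF B] occ_tendsto[of w 0]
  proof eventually_elim
    case (elim x)
    have "eventually (\<lambda>m. visits B m x / real m > 0) sequentially"
      using elim(1) pB by (rule order_tendstoD)
    then obtain m where "visits B m x / real m > 0" by (auto simp: eventually_sequentially)
    then have "visits B m x \<noteq> 0" by auto
    then obtain i where "(\<lambda>j. x (j + int i)) \<in> B"
      unfolding visits_def by (metis (no_types, lifting) indicator_simps(2) sum.neutral)
    then have i: "block x (int i) (int i + int k) = w"
      using block_shift[of x "int i" 0 "int k"] by (simp add: B_def add.commute)
    have "(\<lambda>n. real n powr (- \<gamma>)) \<longlonglongrightarrow> 0"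
      using assms by (intro tendsto_neg_powr filterlim_real_sequentially) auto
    then have "(\<lambda>n. real (occ x w \<lceil>real n / 2\<rceil> (int n)) / real n - real n powr (- \<gamma>)) \<longlonglongrightarrow> Pr w / 2 - 0"
      using elim by (intro tendsto_diff) auto
    then have "eventually (\<lambda>n. real (occ x w \<lceil>real n / 2\<rceil> (int n)) / real n - real n powr (- \<gamma>) > 0) sequentially"
      using w by (intro order_tendstoD(1)[of _ "Pr w / 2 - 0"]) auto
    then show ?case
      using eventually_ge_at_top[of "2 * (i + k + 1)"]
    proof eventually_elim
      case (elim n)
      then have n: "n > 0" by simp
      have "real n powr (1 - \<gamma>) = real n * real n powr (- \<gamma>)"
        using n by (simp add: powr_diff powr_minus_divide)
      then have "w \<in> S2 \<gamma> x n k"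
        using elim(1) n len by (simp add: S2_occ field_simps)
      moreover have "int i + int k \<le> \<lceil>real n / 2\<rceil> - 1"
      proof -
        have "real (2 * (i + k + 1)) \<le> real n" using elim(2) by (simp only: of_nat_le_iff)
        then have "of_int (int i + int k + 1) \<le> real n / 2" by simp
        also have "\<dots> \<le> of_int \<lceil>real n / 2\<rceil>" by (rule le_of_int_ceiling)
        finally have "int i + int k + 1 \<le> \<lceil>real n / 2\<rceil>" by (simp only: of_int_le_iff)
        then show ?thesis by simp
      qed
      then have "w \<in> S1 x n k"
        using i len by (auto simp: S1_def intro!: exI[of _ "int i + int k"])
      ultimately show ?case by (simp add: S_def)
    qed
  qed
qed

text \<open>The maximum is at least the difference at one fixed witness \<open>(z, a)\<close>, which
  tends to a nonzero limit, while the threshold tends to 0.\<close>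

lemma eventually_Delta_hat_gt:
  assumes "0 < \<gamma>" "0 < \<beta>" and nm: "\<not> markov_with Q (\<lambda>j x. x j) k"
  shows "AE x in Q. eventually (\<lambda>n. real n powr (- \<beta>) < Delta_hat \<gamma> x n k) sequentially"
proof -
  obtain y i z where i: "i \<ge> 1" and len: "length z = k + i" and z: "Pr z > 0"
    and ne: "Nx y (drop i z) \<noteq> Nx y z"
    using nm unfolding markov_with_def by blast
  have dz: "Pr (drop i z) > 0" using z Pr_suffix[of z i] by linarith
  obtain a where a: "Nx a (drop i z) < Nx a z"
    using exists_greater_next_prob[OF dz z ne] by blast
  moreover have "0 \<le> Nx a (drop i z)" by (simp add: Nx_eq Pr_nonneg)
  ultimately have "Nx a z > 0" by linarith
  then have za: "Pr (z @ [a]) > 0"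
    using z Pr_nonneg[of "z @ [a]"] by (auto simp: Nx_eq zero_less_divide_iff)
  have "AE x in Q. eventually (\<lambda>n. z @ [a] \<in> S \<gamma> x n (k + i)) sequentially"
    using assms(1) za len by (intro eventually_in_S) auto
  with emp_cond_prob_tendsto[OF z, of a] emp_cond_prob_tendsto[OF dz, of a] show ?thesis
  proof eventually_elim
    case (elim x)
    have "(\<lambda>n. real n powr (- \<beta>)) \<longlonglongrightarrow> 0"
      using assms by (intro tendsto_neg_powr filterlim_real_sequentially) auto
    then have "(\<lambda>n. \<bar>emp_cond_prob x a (drop i z) \<lceil>real n / 2\<rceil> (int n)
       - emp_cond_prob x a z \<lceil>real n / 2\<rceil> (int n)\<bar> - real n powr (- \<beta>))
       \<longlonglongrightarrow> \<bar>Nx a (drop i z) - Nx a z\<bar> - 0"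
      using elim by (intro tendsto_intros) auto
    then have "eventually (\<lambda>n. \<bar>emp_cond_prob x a (drop i z) \<lceil>real n / 2\<rceil> (int n)
       - emp_cond_prob x a z \<lceil>real n / 2\<rceil> (int n)\<bar> - real n powr (- \<beta>) > 0) sequentially"
      using a by (intro order_tendstoD) auto
    with elim(3) eventually_ge_at_top[of i] show ?case
    proof eventually_elim
      case (elim n)
      then show ?case using Delta_hat_ge[OF i _ len, of n a \<gamma> x] by linarith
    qed
  qed
qed

end

section \<open>Deviation bounds for Markov chains\<close>

lemma exp_le_quadratic:
  fixes x :: real
  assumes "\<bar>x\<bar> \<le> 1"
  shows "exp x \<le> 1 + x + x\<^sup>2"
proof (cases "x \<ge> 0")
  case True
  then show ?thesis using assms by (intro exp_bound) auto
next
  case False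
  define y where "y = - x"
  have y: "y \<ge> 0" using False by (simp add: y_def)
  \<comment> \<open>The claim for \<open>- y\<close> says that
    \<open>(1 - y + y\<^sup>2) * exp y\<close> is at least 1; here \<open>exp y\<close> is replaced
    by its quadratic Taylor lower bound.\<close>
  have "1 \<le> (1 - y + y\<^sup>2) * (1 + y + y\<^sup>2 / 2)"
  proof -
    have "(1 - y + y\<^sup>2) * (1 + y + y\<^sup>2 / 2) = 1 + y\<^sup>2 / 2 + y ^ 3 / 2 + y ^ 4 / 2"
      by (simp add: field_simps power2_eq_square power3_eq_cube power4_eq_xxxx)
    then show ?thesis using y by simp
  qed
  also have "\<dots> \<le> (1 - y + y\<^sup>2) * exp y"
  proof (intro mult_left_mono exp_lower_Taylor_quadratic y)
    have "1 - y + y\<^sup>2 = (1 - y / 2)\<^sup>2 + 3 / 4 * y\<^sup>2" by (simp add: power2_eq_square field_simps)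
    then show "0 \<le> 1 - y + y\<^sup>2" by simp
  qed
  finally have "exp (- y) \<le> 1 - y + y\<^sup>2"
    by (simp add: exp_minus field_simps)
  then show ?thesis by (simp add: y_def)
qed

text \<open>After centring, the linear terms of the exponential cancel and the quadratic ones total
  c^2 p (1 - p), at most c^2. The subtracted \<open>c\<^sup>2\<close> compensates, as 1 + c^2 is at
  most exp (c^2).\<close>

lemma centered_Bernoulli_mgf_le:
  fixes p c :: real
  assumes p: "0 \<le> p" "p \<le> 1" and c: "\<bar>c\<bar> \<le> 1"
  shows "p * exp (c * (1 - p) - c\<^sup>2) + (1 - p) * exp (c * (0 - p) - c\<^sup>2) \<le> 1"
proof -
  have *: "\<bar>c * q\<bar> \<le> 1" if "\<bar>q\<bar> \<le> 1" for q
    using mult_mono[OF c that] by (simp add: abs_mult)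
  have "p * exp (c * (1 - p)) + (1 - p) * exp (c * (0 - p))
     \<le> p * (1 + c * (1 - p) + (c * (1 - p))\<^sup>2) + (1 - p) * (1 + c * (0 - p) + (c * (0 - p))\<^sup>2)"
    using p by (intro add_mono mult_left_mono exp_le_quadratic *) auto
  also have "\<dots> = 1 + c\<^sup>2 * (p * (1 - p))"
    by (simp add: power2_eq_square algebra_simps)
  also have "\<dots> \<le> 1 + c\<^sup>2 * 1"
    using p mult_le_one[of p "1 - p"] by (intro add_left_mono mult_left_mono) auto
  also have "\<dots> \<le> exp (c\<^sup>2)" using exp_ge_add_one_self[of "c\<^sup>2"] by simp
  finally show ?thesis
    by (simp add: exp_diff add_divide_distrib[symmetric])
qed

section \<open>Counts over windows, and finite histories\<close>

lemma block_cong: "(\<And>j. m \<le> j \<Longrightarrow> j \<le> n \<Longrightarrow> x j = y j) \<Longrightarrow> block x m n = block y m n"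
  by (auto simp: block_def)

lemma occ_cong:
  assumes "\<And>j. n1 \<le> j \<Longrightarrow> j \<le> n2 \<Longrightarrow> x j = y j"
  shows "occ x w n1 n2 = occ y w n1 n2"
proof -
  have "block x (t - int (length w) + 1) t = block y (t - int (length w) + 1) t"
    if "n1 + int (length w) - 1 \<le> t" "t \<le> n2" for t
    using that assms by (intro block_cong) auto
  then show ?thesis unfolding occ_def by (metis (no_types, lifting))
qed

lemma occ_empty:
  assumes "n2 < n1 + int (length w) - 1"
  shows "occ x w n1 n2 = 0"
proof -
  have "{t. n1 + int (length w) - 1 \<le> t \<and> t \<le> n2 \<and> block x (t - int (length w) + 1) t = w} = {}"
    using assms by auto
  then show ?thesis by (simp only: occ_def card.empty)
qed

lemma occ_step:
  "occ x w n1 n2 = occ x w n1 (n2 - 1) +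
     (if n1 + int (length w) - 1 \<le> n2 \<and> block x (n2 - int (length w) + 1) n2 = w then 1 else 0)"
proof -
  define A where "A m = {t. n1 + int (length w) - 1 \<le> t \<and> t \<le> m \<and> block x (t - int (length w) + 1) t = w}" for m
  have fin: "finite (A m)" for m
    by (rule finite_subset[of _ "{n1 + int (length w) - 1..m}"]) (auto simp: A_def)
  have *: "t \<le> n2 \<longleftrightarrow> t = n2 \<or> t \<le> n2 - 1" for t by arith
  have "A n2 = (if n1 + int (length w) - 1 \<le> n2 \<and> block x (n2 - int (length w) + 1) n2 = w
    then insert n2 (A (n2 - 1)) else A (n2 - 1))"
    by (auto simp: A_def *)
  moreover have "n2 \<notin> A (n2 - 1)" by (simp add: A_def)
  ultimately show ?thesis
    using fin unfolding occ_def A_def[symmetric] by simp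
qed

text \<open>Natural subtraction truncates, so a list shorter than \<open>K\<close> is its own
  suffix.\<close>

definition suffix :: "nat \<Rightarrow> 'a list \<Rightarrow> 'a list" where
  "suffix K u = drop (length u - K) u"

lemma suffix_suffix: "K \<le> L \<Longrightarrow> suffix K (suffix L u) = suffix K u"
  by (cases "length u \<le> L") (simp_all add: suffix_def)

lemma suffix_block:
  "int L \<le> n - m + 1 \<Longrightarrow> suffix L (block x m n) = block x (n - int L + 1) n"
  unfolding suffix_def
  by (intro nth_equalityI) (auto simp: block_def nth_upto algebra_simps)

text \<open>Recovers a path on \<open>{0..n}\<close> from its block over these times. A functional
  reading only these letters becomes a function of a list, so that it is measurable and is fixed by
  conditioning on the history.\<close>

definition path_of :: "'a list \<Rightarrow> int \<Rightarrow> 'a" where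
  "path_of u = (\<lambda>j. u ! nat j)"

lemma path_of_block: "0 \<le> j \<Longrightarrow> j \<le> n \<Longrightarrow> path_of (block x 0 n) j = x j"
  by (simp add: path_of_def block_def nth_upto)

section \<open>The exponential supermartingale of a Markov chain\<close>

context stationary_law
begin

lemma Pr_snoc_le: "Pr (u @ [y]) \<le> Pr u"
proof -
  define L where "L = int (length u)"
  have *: "block x (1 - L) 1 = block x (1 - L) 0 @ [x 1]" for x :: "int \<Rightarrow> 'a"
    using block_snoc[of "1 - L" 0 x] by (simp add: L_def)
  have "Pr (u @ [y]) = prob {x. block x (1 - L) 1 = u @ [y]}"
    using prob_block_eq[of 1 "u @ [y]"] by (simp add: L_def)
  also have "\<dots> \<le> prob {x. block x (1 - L) 0 = u}"
    by (intro finite_measure_mono sets_block) (auto simp: *)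
  also have "\<dots> = Pr u" by (simp add: str_prob_def L_def)
  finally show ?thesis .
qed

lemma Nx_le_1: "Nx y u \<le> 1"
  using Pr_snoc_le[of u y] Pr_nonneg[of u] by (auto simp: Nx_eq divide_le_eq_1)

lemma Nx_nonneg: "0 \<le> Nx y u"
  by (simp add: Nx_eq Pr_nonneg)

text \<open>Product form of the Markov property. Unlike the conditional form it also covers
  histories of probability 0, where both sides vanish.\<close>

lemma markov_Pr_snoc:
  assumes mk: "markov_with Q (\<lambda>j x. x j) K" and len: "K \<le> length u"
  shows "Pr (u @ [y]) = Nx y (suffix K u) * Pr u"
proof (cases "Pr u = 0")
  case True
  then show ?thesis using Pr_snoc_le[of u y] Pr_nonneg[of "u @ [y]"] by simp
next
  case False
  then have pos: "Pr u > 0" using Pr_nonneg[of u] by simp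
  have "Nx y (suffix K u) = Nx y u"
  \<comment> \<open>\<open>markov_with\<close> speaks of contexts of length \<open>K + 1\<close> and
    more; at length \<open>K\<close> the suffix is \<open>u\<close> itself.\<close>
  proof (cases "length u = K")
    case True
    then show ?thesis by (simp add: suffix_def)
  next
    case False
    then have "length u = K + (length u - K)" "1 \<le> length u - K" using len by auto
    then show ?thesis using mk pos unfolding markov_with_def suffix_def by blast
  qed
  then show ?thesis using pos by (simp add: Nx_eq)
qed

text \<open>Conditioning on the history, as a sum over its countably many values \<open>u\<close>.\<close>

lemma nn_integral_history_le:
  assumes "\<And>u. length u = m \<Longrightarrow>
      (\<integral>\<^sup>+ x. h u (x (int m)) * indicator {x. block x 0 (int m - 1) = u} x \<partial>Q)
      \<le> emeasure Q {x. block x 0 (int m - 1) = u}"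
  shows "(\<integral>\<^sup>+ x. G (block x 0 (int m - 1)) * h (block x 0 (int m - 1)) (x (int m)) \<partial>Q)
     \<le> (\<integral>\<^sup>+ x. G (block x 0 (int m - 1)) \<partial>Q)"
proof -
  define b where "b x = block x 0 (int m - 1)" for x :: "int \<Rightarrow> 'a"
  have bs: "{x. b x = u} \<in> sets Q" for u unfolding b_def by (rule sets_block)
  have hm: "(\<lambda>x. h u (x (int m))) \<in> borel_measurable Q" for u
  proof -
    have "(\<lambda>x. h u (hd (block x (int m) (int m)))) \<in> borel_measurable Q"
      by (rule measurable_compose[OF measurable_block]) simp
    then show ?thesis by (simp add: block_def)
  qed
  \<comment> \<open>For each path exactly one \<open>u\<close> contributes to the sum, and
    nonnegativity allows sum and integral to be exchanged.\<close>
  have disint: "(\<integral>\<^sup>+ x. f (b x) (x (int m)) \<partial>Q)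
     = (\<integral>\<^sup>+ u. \<integral>\<^sup>+ x. f u (x (int m)) * indicator {x. b x = u} x \<partial>Q \<partial>count_space UNIV)"
    if f: "\<And>u. (\<lambda>x. f u (x (int m))) \<in> borel_measurable Q" for f :: "'a list \<Rightarrow> 'a \<Rightarrow> ennreal"
  proof -
    have "f (b x) (x (int m)) = (\<integral>\<^sup>+ u. f u (x (int m)) * indicator {x. b x = u} x \<partial>count_space UNIV)" for x
    proof -
      have "(\<integral>\<^sup>+ u. f u (x (int m)) * indicator {x. b x = u} x \<partial>count_space UNIV)
          = (\<integral>\<^sup>+ u. f u (x (int m)) * indicator {b x} u \<partial>count_space UNIV)"
        by (intro nn_integral_cong) (auto simp: indicator_def)
      also have "\<dots> = f (b x) (x (int m))"
        by (subst nn_integral_indicator_singleton) (auto simp: one_ennreal_def[symmetric])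
      finally show ?thesis ..
    qed
    then have "(\<integral>\<^sup>+ x. f (b x) (x (int m)) \<partial>Q)
      = (\<integral>\<^sup>+ x. \<integral>\<^sup>+ u. f u (x (int m)) * indicator {x. b x = u} x \<partial>count_space UNIV \<partial>Q)"
      by simp
    also have "\<dots> = (\<integral>\<^sup>+ u. \<integral>\<^sup>+ x. f u (x (int m)) * indicator {x. b x = u} x \<partial>Q \<partial>count_space UNIV)"
      using f bs by (intro nn_integral_count_space_nn_integral borel_measurable_times) auto
    finally show ?thesis .
  qed
  have "(\<integral>\<^sup>+ x. G (b x) * h (b x) (x (int m)) \<partial>Q)
     = (\<integral>\<^sup>+ u. \<integral>\<^sup>+ x. G u * h u (x (int m)) * indicator {x. b x = u} x \<partial>Q \<partial>count_space UNIV)"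
    using hm by (intro disint[of "\<lambda>u y. G u * h u y"]) simp
  also have "\<dots> \<le> (\<integral>\<^sup>+ u. \<integral>\<^sup>+ x. G u * indicator {x. b x = u} x \<partial>Q \<partial>count_space UNIV)"
  proof (rule nn_integral_mono)
    fix u
    have "(\<integral>\<^sup>+ x. G u * h u (x (int m)) * indicator {x. b x = u} x \<partial>Q)
        = G u * (\<integral>\<^sup>+ x. h u (x (int m)) * indicator {x. b x = u} x \<partial>Q)"
      using hm bs by (subst nn_integral_cmult[symmetric]) (auto simp: mult.assoc)
    also have "\<dots> \<le> G u * emeasure Q {x. b x = u}"
    proof (cases "length u = m")
      case True
      then show ?thesis using assms[of u] unfolding b_def by (intro mult_left_mono) auto
    next
      case False
      then have "{x. b x = u} = {}" by (auto simp: b_def)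
      then show ?thesis by simp
    qed
    also have "\<dots> = (\<integral>\<^sup>+ x. G u * indicator {x. b x = u} x \<partial>Q)"
      using bs by (simp add: nn_integral_cmult_indicator)
    finally show "(\<integral>\<^sup>+ x. G u * h u (x (int m)) * indicator {x. b x = u} x \<partial>Q)
       \<le> (\<integral>\<^sup>+ x. G u * indicator {x. b x = u} x \<partial>Q)" .
  qed
  also have "\<dots> = (\<integral>\<^sup>+ x. G (b x) \<partial>Q)"
    by (intro disint[of "\<lambda>u y. G u", symmetric]) simp
  finally show ?thesis by (simp add: b_def)
qed

text \<open>Given the history \<open>u\<close>, the next letter is \<open>a\<close> with probability
  \<open>p\<close>, which the Markov property reads off the last \<open>K\<close> letters. What
  remains is the bound for a centred Bernoulli variable.\<close>

lemma markov_exp_step_le: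
  assumes mk: "markov_with Q (\<lambda>j x. x j) K" and m: "K \<le> m" and len: "length u = m" and c: "\<bar>c\<bar> \<le> 1"
  shows "(\<integral>\<^sup>+ x. ennreal (exp (c * ((if x (int m) = a then 1 else 0) - Nx a (suffix K u)) - c\<^sup>2))
        * indicator {x. block x 0 (int m - 1) = u} x \<partial>Q)
      \<le> emeasure Q {x. block x 0 (int m - 1) = u}"
proof -
  define p where "p = Nx a (suffix K u)"
  define e where "e q = exp (c * (q - p) - c\<^sup>2)" for q
  define A where "A = {x. block x 0 (int m - 1) = u}"
  define A1 where "A1 = {x. block x 0 (int m) = u @ [a]}"
  have s: "A \<in> sets Q" "A1 \<in> sets Q" unfolding A_def A1_def by (rule sets_block)+
  have sn: "block x 0 (int m) = block x 0 (int m - 1) @ [x (int m)]" for x :: "int \<Rightarrow> 'a"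
    using block_snoc[of 0 "int m - 1" x] by simp
  have A1: "x \<in> A1 \<longleftrightarrow> x \<in> A \<and> x (int m) = a" for x by (auto simp: A1_def A_def sn)
  then have sub: "A1 \<subseteq> A" by blast
  have PA: "prob A = Pr u" using prob_block_eq[of "int m - 1" u] len by (simp add: A_def)
  have PA1: "prob A1 = p * Pr u"
    using prob_block_eq[of "int m" "u @ [a]"] len markov_Pr_snoc[OF mk, of u a] m
    by (simp add: A1_def p_def)
  have PA2: "prob (A - A1) = (1 - p) * Pr u"
    using finite_measure_Diff[OF s sub] by (simp add: PA PA1 algebra_simps)
  have "(\<integral>\<^sup>+ x. ennreal (e (if x (int m) = a then 1 else 0)) * indicator A x \<partial>Q)
     = (\<integral>\<^sup>+ x. ennreal (e 1) * indicator A1 x + ennreal (e 0) * indicator (A - A1) x \<partial>Q)"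
    by (intro nn_integral_cong) (auto simp: A1 indicator_def)
  also have "\<dots> = ennreal (e 1) * emeasure Q A1 + ennreal (e 0) * emeasure Q (A - A1)"
    using s by (subst nn_integral_add) (auto simp: nn_integral_cmult_indicator)
  also have "\<dots> = ennreal (e 1 * prob A1 + e 0 * prob (A - A1))"
    by (simp add: emeasure_eq_measure ennreal_mult'' e_def)
  also have "e 1 * prob A1 + e 0 * prob (A - A1) = (p * e 1 + (1 - p) * e 0) * Pr u"
    by (simp add: PA1 PA2 algebra_simps)
  also have "ennreal \<dots> \<le> ennreal (1 * Pr u)"
    unfolding e_def p_def
    by (intro ennreal_leI mult_right_mono centered_Bernoulli_mgf_le Nx_nonneg Nx_le_1 c Pr_nonneg)
  finally show ?thesis
    by (simp add: A_def[symmetric] e_def p_def emeasure_eq_measure PA)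
qed

text \<open>The exponential of \<open>log_weight\<close> is a supermartingale in \<open>n\<close>. The string \<open>(z, a)\<close> is not fixed:
  it is read off the path at a time \<open>t < h\<close>, before the counting window \<open>{h..n}\<close>.\<close>

definition log_weight :: "nat \<Rightarrow> real \<Rightarrow> int \<Rightarrow> nat \<Rightarrow> int \<Rightarrow> int \<Rightarrow> (int \<Rightarrow> 'a) \<Rightarrow> real" where
  "log_weight K c h l t n x =
    (let z = block x (t - int l) (t - 1); a = x t in
      c * (real (occ x (z @ [a]) h n) - Nx a (suffix K z) * real (occ x z h (n - 1)))
      - c\<^sup>2 * real (occ x z h (n - 1)))"

lemma log_weight_cong:
  assumes "\<And>j. 0 \<le> j \<Longrightarrow> j \<le> n \<Longrightarrow> x j = y j" and "int l \<le> t" "t < h" "h \<le> n + 1"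
  shows "log_weight K c h l t n x = log_weight K c h l t n y"
proof -
  have "block x (t - int l) (t - 1) = block y (t - int l) (t - 1)"
    using assms by (intro block_cong) auto
  moreover have "x t = y t" using assms by auto
  moreover have "occ x w h n = occ y w h n" "occ x w h (n - 1) = occ y w h (n - 1)" for w
    using assms by (intro occ_cong; auto)+
  ultimately show ?thesis by (simp add: log_weight_def Let_def)
qed

lemma log_weight_path_of:
  assumes "int l \<le> t" "t < h" "h \<le> n + 1"
  shows "log_weight K c h l t n (path_of (block x 0 n)) = log_weight K c h l t n x"
  using assms by (intro log_weight_cong path_of_block)

text \<open>A step matters only if the \<open>l\<close> letters before time \<open>n + 1\<close>,
  all in the window, spell the string read before \<open>t\<close>. Because
  \<open>log_weight\<close> counts that string up to \<open>n - 1\<close> only, a visit enters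
  together with the letter that follows it, which keeps the count centred.\<close>

lemma log_weight_step:
  assumes "int l \<le> t" "t < h" "h \<le> n + 1"
  shows "log_weight K c h l t (n + 1) x = log_weight K c h l t n x +
    (if h + int l \<le> n + 1 \<and> block x (n + 1 - int l) n = block x (t - int l) (t - 1)
     then c * ((if x (n + 1) = x t then 1 else 0) - Nx (x t) (suffix K (block x (t - int l) (t - 1)))) - c\<^sup>2
     else 0)"
proof -
  define z where "z = block x (t - int l) (t - 1)"
  have len: "length z = l" by (simp add: z_def)
  have sn: "block x (n - int l + 1) (n + 1) = block x (n + 1 - int l) n @ [x (n + 1)]"
    using block_snoc[of "n - int l + 1" n x] by (simp add: algebra_simps)
  have 1: "occ x (z @ [x t]) h (n + 1) = occ x (z @ [x t]) h n +
     (if h + int l \<le> n + 1 \<and> block x (n + 1 - int l) n = z \<and> x (n + 1) = x t then 1 else 0)"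
    using occ_step[of x "z @ [x t]" h "n + 1"] by (auto simp: len sn)
  have 2: "occ x z h n = occ x z h (n - 1) +
     (if h + int l \<le> n + 1 \<and> block x (n + 1 - int l) n = z then 1 else 0)"
    using occ_step[of x z h n] by (auto simp: len algebra_simps)
  show ?thesis
    unfolding log_weight_def Let_def z_def[symmetric] 1
    by (simp add: 2 algebra_simps)
qed

text \<open>Induction from the empty window \<open>n = h - 1\<close>, where the weight is 0. As
  \<open>t < h\<close>, string and letter belong to the history up to \<open>n\<close>; conditioning
  on all of it fixes them, and \<open>markov_exp_step_le\<close> bounds the factor contributed by
  time \<open>n + 1\<close>.\<close>

lemma log_weight_mgf_le:
  assumes mk: "markov_with Q (\<lambda>j x. x j) K" and c: "\<bar>c\<bar> \<le> 1"
    and "K \<le> l" "int l \<le> t" "t < h" and "h \<le> n + 1"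
  shows "(\<integral>\<^sup>+ x. ennreal (exp (log_weight K c h l t n x)) \<partial>Q) \<le> 1"
proof -
  from \<open>h \<le> n + 1\<close> have "h - 1 \<le> n" by simp
  then show ?thesis
  proof (induction n rule: int_ge_induct)
    case base
    have "log_weight K c h l t (h - 1) x = 0" for x
      by (simp add: log_weight_def Let_def occ_empty)
    then show ?case by (simp add: emeasure_space_1[simplified])
  next
    case (step n)
    define m where "m = nat (n + 1)"
    have m: "int m = n + 1" using step assms by (simp add: m_def)
    define V where "V x \<longleftrightarrow> h + int l \<le> n + 1 \<and> block x (n + 1 - int l) n = block x (t - int l) (t - 1)"
      for x :: "int \<Rightarrow> 'a"
    define h' where "h' u y = (if V (path_of u) then
      ennreal (exp (c * ((if y = path_of u t then 1 else 0) - Nx (path_of u t) (suffix K u)) - c\<^sup>2)) else 1)"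
      for u y
    define G where "G u = ennreal (exp (log_weight K c h l t n (path_of u)))" for u
    have G: "G (block x 0 (int m - 1)) = ennreal (exp (log_weight K c h l t n x))" for x
      using log_weight_path_of[of l t h n K c x] step assms by (simp add: G_def m)
    have h': "h' (block x 0 (int m - 1)) (x (int m)) = (if V x then
      ennreal (exp (c * ((if x (n + 1) = x t then 1 else 0) - Nx (x t) (suffix K (block x (t - int l) (t - 1)))) - c\<^sup>2)) else 1)" for x
    proof -
      have y: "path_of (block x 0 n) j = x j" if "0 \<le> j" "j \<le> n" for j
        using that by (rule path_of_block)
      have "V (path_of (block x 0 n)) = V x"
      proof -
        have "block (path_of (block x 0 n)) (t - int l) (t - 1) = block x (t - int l) (t - 1)"
          using step assms by (intro block_cong y) auto
        moreover have "block (path_of (block x 0 n)) (n + 1 - int l) n = block x (n + 1 - int l) n"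
          using step assms by (intro block_cong y) auto
        ultimately show ?thesis by (simp add: V_def)
      qed
      moreover have "path_of (block x 0 n) t = x t" using step assms by (intro y) auto
      \<comment> \<open>On a visit the last \<open>l\<close> letters are those read before
        \<open>t\<close>, and since \<open>K \<le> l\<close> they determine the context of length
        \<open>K\<close>.\<close>
      moreover have "suffix K (block x 0 n) = suffix K (block x (t - int l) (t - 1))" if "V x"
      proof -
        have "suffix K (block x 0 n) = suffix K (suffix l (block x 0 n))"
          using assms by (simp add: suffix_suffix)
        also have "suffix l (block x 0 n) = block x (n + 1 - int l) n"
          using step assms by (subst suffix_block) (auto simp: algebra_simps)
        also have "\<dots> = block x (t - int l) (t - 1)" using that by (simp add: V_def)
        finally show ?thesis .
      qed
      ultimately show ?thesis by (simp add: h'_def m)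
    qed
    have "(\<integral>\<^sup>+ x. ennreal (exp (log_weight K c h l t (n + 1) x)) \<partial>Q)
      = (\<integral>\<^sup>+ x. G (block x 0 (int m - 1)) * h' (block x 0 (int m - 1)) (x (int m)) \<partial>Q)"
    proof (intro nn_integral_cong)
      fix x
      show "ennreal (exp (log_weight K c h l t (n + 1) x))
        = G (block x 0 (int m - 1)) * h' (block x 0 (int m - 1)) (x (int m))"
        using log_weight_step[of l t h n K c x] step assms
        unfolding G h' by (simp add: V_def[symmetric] exp_add ennreal_mult)
    qed
    also have "\<dots> \<le> (\<integral>\<^sup>+ x. G (block x 0 (int m - 1)) \<partial>Q)"
    proof (rule nn_integral_history_le)
      fix u :: "'a list" assume u: "length u = m"
      show "(\<integral>\<^sup>+ x. h' u (x (int m)) * indicator {x. block x 0 (int m - 1) = u} x \<partial>Q)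
        \<le> emeasure Q {x. block x 0 (int m - 1) = u}"
      proof (cases "V (path_of u)")
        case True
        then show ?thesis
          using markov_exp_step_le[OF mk _ u c, of "path_of u t"] step assms
          by (simp add: h'_def m_def)
      next
        case False
        then show ?thesis using sets_block[of "\<lambda>v. v = u" 0 "int m - 1"] by (simp add: h'_def)
      qed
    qed
    also have "\<dots> = (\<integral>\<^sup>+ x. ennreal (exp (log_weight K c h l t n x)) \<partial>Q)"
      by (simp add: G)
    also have "\<dots> \<le> 1" using step by simp
    finally show ?case by simp
  qed
qed

lemma log_weight_tail_le:
  assumes mk: "markov_with Q (\<lambda>j x. x j) K" and c: "\<bar>c\<bar> \<le> 1"
    and "K \<le> l" "int l \<le> t" "t < h" and "h \<le> n + 1"
  shows "{x. r \<le> log_weight K c h l t n x} \<in> sets Q"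
    and "prob {x. r \<le> log_weight K c h l t n x} \<le> exp (- r)"
proof -
  have eq: "log_weight K c h l t n (path_of (block x 0 n)) = log_weight K c h l t n x" for x
    using assms by (intro log_weight_path_of) auto
  show s: "{x. r \<le> log_weight K c h l t n x} \<in> sets Q"
    using sets_block[of "\<lambda>u. r \<le> log_weight K c h l t n (path_of u)" 0 n] by (simp add: eq)
  have m: "(\<lambda>x. ennreal (exp (log_weight K c h l t n x))) \<in> borel_measurable Q"
  proof -
    have "(\<lambda>x. ennreal (exp (log_weight K c h l t n (path_of (block x 0 n))))) \<in> borel_measurable Q"
      by (rule measurable_compose[OF measurable_block]) simp
    then show ?thesis by (simp add: eq)
  qed
  have "emeasure Q {x. r \<le> log_weight K c h l t n x}
     = emeasure Q {x \<in> space Q. 1 \<le> ennreal (exp (- r)) * ennreal (exp (log_weight K c h l t n x))}"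
    by (simp add: ennreal_mult[symmetric] exp_add[symmetric])
  also have "\<dots> \<le> ennreal (exp (- r)) * (\<integral>\<^sup>+ x. ennreal (exp (log_weight K c h l t n x)) * indicator (space Q) x \<partial>Q)"
    using m sets.top[of Q] by (intro nn_integral_Markov_inequality) auto
  also have "\<dots> \<le> ennreal (exp (- r)) * 1"
    using log_weight_mgf_le[OF assms] by (intro mult_left_mono) auto
  finally show "prob {x. r \<le> log_weight K c h l t n x} \<le> exp (- r)"
    by (simp add: emeasure_eq_measure)
qed

end

text \<open>Moving \<open>t\<close> back by one embeds the occurrences of \<open>z @ [a]\<close>
  into those of \<open>z\<close>. Thus the frequency that \<open>S2\<close> demands of tested
  strings also bounds the denominators from below.\<close>

lemma occ_snoc_le: "occ x (z @ [a]) n1 n2 \<le> occ x z n1 (n2 - 1)"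
proof -
  define L where "L = int (length z)"
  have fin: "finite {t. n1 + L - 1 \<le> t \<and> t \<le> n2 - 1 \<and> block x (t - L + 1) t = z}"
    by (rule finite_subset[of _ "{n1 + L - 1..n2 - 1}"]) auto
  have sn: "block x (t - L) t = block x (t - L) (t - 1) @ [x t]" for t
    using block_snoc[of "t - L" "t - 1" x] by (simp add: L_def)
  have "card {t. n1 + L \<le> t \<and> t \<le> n2 \<and> block x (t - L) t = z @ [a]}
      \<le> card {t. n1 + L - 1 \<le> t \<and> t \<le> n2 - 1 \<and> block x (t - L + 1) t = z}"
    by (rule card_inj_on_le[where f = "\<lambda>t. t - 1", OF _ _ fin]) (auto simp: inj_on_def sn)
  then show ?thesis by (simp add: occ_def L_def algebra_simps)
qed

lemma occ_drop_le:
  assumes "i \<le> length w"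
  shows "occ x w n1 n2 \<le> occ x (drop i w) n1 n2"
  unfolding occ_def
proof (rule card_mono)
  show "finite {t. n1 + int (length (drop i w)) - 1 \<le> t \<and> t \<le> n2 \<and> block x (t - int (length (drop i w)) + 1) t = drop i w}"
    by (rule finite_subset[of _ "{n1 + int (length (drop i w)) - 1..n2}"]) auto
  have "block x (t - int (length (drop i w)) + 1) t = drop i (block x (t - int (length w) + 1) t)" for t
    using assms by (intro nth_equalityI) (auto simp: block_def nth_upto algebra_simps of_nat_diff)
  then show "{t. n1 + int (length w) - 1 \<le> t \<and> t \<le> n2 \<and> block x (t - int (length w) + 1) t = w}
    \<subseteq> {t. n1 + int (length (drop i w)) - 1 \<le> t \<and> t \<le> n2 \<and> block x (t - int (length (drop i w)) + 1) t = drop i w}"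
    by auto
qed

lemma summable_poly_exp_powr:
  assumes "0 < d"
  shows "summable (\<lambda>n. 2 * (real n + 1)\<^sup>2 * exp (- (real n powr d / 16)))"
proof (rule summable_comparison_test_bigo)
  show "summable (\<lambda>n. norm (1 / real n ^ 2))"
    using inverse_power_summable[of 2, where ?'a = real] by (simp add: field_simps)
  show "(\<lambda>n. 2 * (real n + 1)\<^sup>2 * exp (- (real n powr d / 16))) \<in> O(\<lambda>n. 1 / real n ^ 2)"
    using assms by real_asymp
qed

section \<open>Union bound and Borel-Cantelli for a correct order\<close>

context stationary_law
begin

text \<open>Over visits exceeding \<open>q\<close> in number, a deviation of more than \<open>e\<close> in direction \<open>s\<close> makes the
  \<open>log_weight\<close> with parameter \<open>s e / 2\<close> exceed \<open>e\<^sup>2 q / 4\<close>, whatever the actual number of visits; hence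
  the threshold \<open>r\<close> with which the event is used.\<close>

definition deviation_event :: "nat \<Rightarrow> real \<Rightarrow> real \<Rightarrow> nat \<Rightarrow> (int \<Rightarrow> 'a) set" where
  "deviation_event K e r n =
    (\<Union>(l, t, s) \<in> {(l, t, s). (l, t, s) \<in> {..n} \<times> {..n} \<times> {-1, 1} \<and> K \<le> l \<and> l \<le> t \<and> int t < \<lceil>real n / 2\<rceil>}.
      {x. r \<le> log_weight K (s * e / 2) \<lceil>real n / 2\<rceil> l (int t) (int n) x})"

text \<open>A union bound over lengths, positions and two signs, at most 2 (n + 1)^2 events.
  Indexing by the position at which a string is read, not by the string, keeps their number finite
  for an infinite alphabet.\<close>

lemma deviation_event_prob:
  assumes mk: "markov_with Q (\<lambda>j x. x j) K" and e: "0 \<le> e" "e \<le> 1"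
  shows "deviation_event K e r n \<in> sets Q"
    and "prob (deviation_event K e r n) \<le> 2 * (real n + 1)\<^sup>2 * exp (- r)"
proof -
  define I where "I = {(l, t, s). (l, t, s) \<in> {..n} \<times> {..n} \<times> {-1, 1 :: real} \<and> K \<le> l \<and> l \<le> t \<and> int t < \<lceil>real n / 2\<rceil>}"
  define A where "A = (\<lambda>(l, t, s). {x. r \<le> log_weight K (s * e / 2) \<lceil>real n / 2\<rceil> l (int t) (int n) x})"
  have eq: "deviation_event K e r n = (\<Union>i\<in>I. A i)"
    by (simp add: deviation_event_def I_def A_def)
  have sub: "I \<subseteq> {..n} \<times> {..n} \<times> {-1, 1}" by (auto simp: I_def)
  have fin: "finite I" by (rule finite_subset[OF sub]) auto
  have "card I \<le> card ({..n} \<times> {..n} \<times> {-1, 1 :: real})" by (rule card_mono[OF _ sub]) auto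
  then have card: "card I \<le> 2 * (n + 1)\<^sup>2" by (simp add: card_cartesian_product power2_eq_square algebra_simps)
  have n: "\<lceil>real n / 2\<rceil> \<le> int n + 1" by linarith
  have A: "A i \<in> sets Q \<and> prob (A i) \<le> exp (- r)" if "i \<in> I" for i
  proof -
    obtain l t s where i: "i = (l, t, s)" by (cases i) auto
    have "\<bar>s * e / 2\<bar> \<le> 1" using that e by (auto simp: i I_def abs_mult)
    then show ?thesis
      using that n log_weight_tail_le[OF mk, of "s * e / 2" l "int t" "\<lceil>real n / 2\<rceil>" "int n" r]
      by (auto simp: i I_def A_def)
  qed
  show "deviation_event K e r n \<in> sets Q"
    unfolding eq using A fin by (intro sets.finite_UN) auto
  have "prob (deviation_event K e r n) \<le> (\<Sum>i\<in>I. prob (A i))"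
    unfolding eq using A fin by (intro finite_measure_subadditive_finite) auto
  also have "\<dots> \<le> (\<Sum>i\<in>I. exp (- r))" using A by (intro sum_mono) auto
  also have "\<dots> = real (card I) * exp (- r)" by simp
  also have "\<dots> \<le> real (2 * (n + 1)\<^sup>2) * exp (- r)"
    using card by (intro mult_right_mono) (simp_all only: of_nat_le_iff exp_ge_zero)
  finally show "prob (deviation_event K e r n) \<le> 2 * (real n + 1)\<^sup>2 * exp (- r)"
    by (simp add: add.commute)
qed

lemma emp_cond_prob_deviation_le:
  assumes x: "x \<notin> deviation_event K e (e\<^sup>2 * q / 4) n" and e: "0 < e" and q: "0 < q"
    and "K \<le> l" "int l \<le> t" "t < \<lceil>real n / 2\<rceil>"
    and z: "block x (t - int l) (t - 1) = z" and a: "x t = a"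
    and num: "q < real (occ x (z @ [a]) \<lceil>real n / 2\<rceil> (int n))"
  shows "\<bar>emp_cond_prob x a z \<lceil>real n / 2\<rceil> (int n) - Nx a (suffix K z)\<bar> \<le> e"
proof (rule ccontr)
  assume neg: "\<not> ?thesis"
  define h where "h = \<lceil>real n / 2\<rceil>"
  define N where "N = real (occ x z h (int n - 1))"
  define d where "d = real (occ x (z @ [a]) h (int n)) - Nx a (suffix K z) * N"
  have "q \<le> N" using num occ_snoc_le[of x z a h "int n"] by (simp add: N_def h_def)
  then have N: "N > 0" "q \<le> N" using q by auto
  have "emp_cond_prob x a z h (int n) - Nx a (suffix K z) = d / N"
    using N by (simp add: emp_cond_prob_occ d_def N_def[symmetric] field_simps)
  then have "e < \<bar>d\<bar> / N" using neg N by (simp add: h_def abs_divide)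
  then have d: "e * N < \<bar>d\<bar>" using N by (simp add: field_simps)
  define s :: real where "s = (if d > 0 then 1 else -1)"
  have s: "s * d = \<bar>d\<bar>" "s\<^sup>2 = 1" "s \<in> {-1, 1}" by (auto simp: s_def)
  have hn: "h \<le> int n" unfolding h_def by linarith
  have lt: "l \<le> n" "nat t \<le> n" "0 \<le> t" "l \<le> nat t" using assms(5,6) hn by (auto simp: h_def)
  \<comment> \<open>The parameter e/2 maximises c e N - c^2 N over c, with value e^2 N / 4; as the
    number \<open>N\<close> of visits is at least \<open>q\<close>, the final threshold is free of
    \<open>N\<close>.\<close>
  have "e\<^sup>2 * q / 4 \<le> e\<^sup>2 * N / 4" using N by (simp add: mult_left_mono)
  also have "\<dots> = e / 2 * (e * N) - (e / 2)\<^sup>2 * N" by (simp add: power2_eq_square field_simps)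
  also have "\<dots> \<le> e / 2 * \<bar>d\<bar> - (e / 2)\<^sup>2 * N"
    using d e by (intro diff_right_mono mult_left_mono) auto
  also have "\<dots> = s * e / 2 * d - (s * e / 2)\<^sup>2 * N"
    unfolding power_mult_distrib power_divide s(2) s(1)[symmetric] by simp
  also have "\<dots> = log_weight K (s * e / 2) h l t (int n) x"
    by (simp add: log_weight_def z a d_def N_def Let_def)
  finally have "e\<^sup>2 * q / 4 \<le> log_weight K (s * e / 2) h l (int (nat t)) (int n) x"
    using lt by simp
  then have "x \<in> deviation_event K e (e\<^sup>2 * q / 4) n"
    unfolding deviation_event_def h_def[symmetric]
    using lt s(3) assms(4,6) by (intro UN_I[of "(l, nat t, s)"]) (auto simp: h_def)
  then show False using x by simp
qed

text \<open>Triangle inequality through the common value \<open>Nx a (drop i z)\<close>. A string in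
  \<open>S\<close> is read at some \<open>t\<close> in the first half, and so is its suffix; the
  deviation bound applies with \<open>l = K + i\<close> and \<open>l = K\<close>, each at cost
  \<open>e\<close>.\<close>

lemma Delta_hat_le_of_not_deviation:
  assumes n: "n \<ge> 1" and x: "x \<notin> deviation_event K e (e\<^sup>2 * real n powr (1 - \<gamma>) / 4) n" and e: "0 < e"
  shows "Delta_hat \<gamma> x n K \<le> 2 * e"
proof (rule Delta_hat_le)
  show "0 \<le> 2 * e" using e by simp
next
  fix i z a
  assume i: "1 \<le> i" and len: "length z = K + i" and S: "z @ [a] \<in> S \<gamma> x n (K + i)"
  define h where "h = \<lceil>real n / 2\<rceil>"
  have q: "0 < real n powr (1 - \<gamma>)" using n by simp
  obtain t where t: "int (K + i) \<le> t" "t < h" "block x (t - int (K + i)) t = z @ [a]"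
    using S unfolding S_def S1_def h_def by auto
  have za: "block x (t - int (K + i)) (t - 1) = z" "x t = a"
    using t(3) block_snoc[of "t - int (K + i)" "t - 1" x] by auto
  have suf: "suffix K z = drop i z" "suffix K (drop i z) = drop i z"
    using len by (simp_all add: suffix_def)
  have "block x (t - int K) (t - 1) = suffix K z"
    using suffix_block[of K "t - 1" "t - int (K + i)" x] za by simp
  then have dz: "block x (t - int K) (t - 1) = drop i z" using suf by simp
  have num: "real n powr (1 - \<gamma>) < real (occ x (z @ [a]) h (int n))"
    using S by (simp add: S_def S2_occ h_def)
  have num': "real n powr (1 - \<gamma>) < real (occ x (drop i z @ [a]) h (int n))"
    using num occ_drop_le[of i "z @ [a]" x h "int n"] len by simp
  have "\<bar>emp_cond_prob x a z h (int n) - Nx a (suffix K z)\<bar> \<le> e"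
    using emp_cond_prob_deviation_le[OF x e q _ t(1) _ za] t(2) num by (simp add: h_def)
  moreover have "\<bar>emp_cond_prob x a (drop i z) h (int n) - Nx a (suffix K (drop i z))\<bar> \<le> e"
    using emp_cond_prob_deviation_le[OF x e q _ _ _ dz za(2)] t num' by (simp add: h_def)
  ultimately show "\<bar>emp_cond_prob x a (drop i z) \<lceil>real n / 2\<rceil> (int n)
      - emp_cond_prob x a z \<lceil>real n / 2\<rceil> (int n)\<bar> \<le> 2 * e"
    unfolding suf h_def by linarith
qed

lemma eventually_Delta_hat_le:
  assumes "0 < \<beta>" and "\<beta> < (1 - \<gamma>) / 2" and mk: "markov_with Q (\<lambda>j x. x j) K"
  shows "AE x in Q. eventually (\<lambda>n. Delta_hat \<gamma> x n K \<le> real n powr (- \<beta>)) sequentially"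
proof -
  \<comment> \<open>Half the threshold, because two empirical probabilities are compared.\<close>
  define e where "e n = real n powr (- \<beta>) / 2" for n :: nat
  define r where "r n = (e n)\<^sup>2 * real n powr (1 - \<gamma>) / 4" for n :: nat
  \<comment> \<open>The exponent left when a squared deviation of order n^(-2
    \<open>\<beta>\<close>) meets n^(1 - \<open>\<gamma>\<close>) visits; the upper bound on
    \<open>\<beta>\<close> says exactly that it is positive.\<close>
  define d where "d = 1 - \<gamma> - 2 * \<beta>"
  have d: "d > 0" using assms by (simp add: d_def)
  have e: "0 \<le> e n" "e n \<le> 1" for n
  proof -
    show "0 \<le> e n" by (simp add: e_def)
    have "real n powr (- \<beta>) \<le> 1"
    proof (cases "n = 0")
      case False
      then have "real n powr (- \<beta>) \<le> real n powr 0" using assms by (intro powr_mono) auto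
      then show ?thesis using False by simp
    qed simp
    then show "e n \<le> 1" by (simp add: e_def)
  qed
  have r: "r n = real n powr d / 16" for n
  proof -
    have "(real n powr (- \<beta>))\<^sup>2 * real n powr (1 - \<gamma>) = real n powr d"
      by (simp add: power2_eq_square powr_add[symmetric] d_def)
    then show ?thesis by (simp add: r_def e_def power_divide)
  qed
  have "AE x in Q. eventually (\<lambda>n. x \<in> space Q - deviation_event K (e n) (r n) n) sequentially"
  proof (rule borel_cantelli_AE1)
    show "summable (\<lambda>n. prob (deviation_event K (e n) (r n) n))"
    proof (rule summable_comparison_test'[OF summable_poly_exp_powr[OF d]])
      show "norm (prob (deviation_event K (e n) (r n) n))
        \<le> 2 * (real n + 1)\<^sup>2 * exp (- (real n powr d / 16))" if "n \<ge> 0" for n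
        using deviation_event_prob(2)[OF mk e, of n "r n" n] by (simp add: r)
    qed
  qed (use deviation_event_prob(1)[OF mk e] in \<open>auto simp: emeasure_eq_measure\<close>)
  then show ?thesis
  proof eventually_elim
    case (elim x)
    from elim eventually_ge_at_top[of 1] show ?case
    proof eventually_elim
      case (elim n)
      then have "Delta_hat \<gamma> x n K \<le> 2 * e n"
        by (intro Delta_hat_le_of_not_deviation) (auto simp: r_def[symmetric], simp add: e_def)
      then show ?case by (simp add: e_def)
    qed
  qed
qed

end

section \<open>Consistency of the estimator\<close>

lemma chi_le: "k < n \<Longrightarrow> Delta_hat \<gamma> x n k \<le> real n powr (- \<beta>) \<Longrightarrow> chi \<gamma> \<beta> x n \<le> k"
  by (auto simp: chi_def intro: Least_le)

text \<open>Since the minimum in \<open>chi\<close> exists, \<open>chi\<close> itself passes the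
  threshold and so is none of the rejected \<open>j\<close>.\<close>

lemma chi_ge:
  assumes "n \<ge> 1" and "\<And>j. j < k \<Longrightarrow> real n powr (- \<beta>) < Delta_hat \<gamma> x n j"
  shows "k \<le> chi \<gamma> \<beta> x n"
proof -
  have "Delta_hat \<gamma> x n (chi \<gamma> \<beta> x n) \<le> real n powr (- \<beta>)"
    using LeastI_ex[OF chi_exists[OF assms(1), of \<gamma> x \<beta>]] assms(1) by (simp add: chi_def)
  then show ?thesis using assms(2)[of "chi \<gamma> \<beta> x n"] by (meson not_le)
qed

context ergodic_law
begin

lemma eventually_chi_ge:
  assumes "0 < \<gamma>" "0 < \<beta>" and "\<And>j. j < k \<Longrightarrow> \<not> markov_with Q (\<lambda>j x. x j) j"
  shows "AE x in Q. eventually (\<lambda>n. k \<le> chi \<gamma> \<beta> x n) sequentially"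
proof -
  have "AE x in Q. \<forall>j\<in>{..<k}. eventually (\<lambda>n. real n powr (- \<beta>) < Delta_hat \<gamma> x n j) sequentially"
    using assms by (intro AE_finite_allI eventually_Delta_hat_gt) auto
  then show ?thesis
  proof eventually_elim
    case (elim x)
    then have "eventually (\<lambda>n. \<forall>j\<in>{..<k}. real n powr (- \<beta>) < Delta_hat \<gamma> x n j) sequentially"
      by (intro eventually_ball_finite) auto
    with eventually_ge_at_top[of 1] show ?case
      by eventually_elim (auto intro: chi_ge)
  qed
qed

lemma eventually_chi_eq_markov_order:
  assumes "0 < \<gamma>" "0 < \<beta>" "\<beta> < (1 - \<gamma>) / 2" and "markov_chain Q (\<lambda>j x. x j)"
  shows "AE x in Q. eventually (\<lambda>n. chi \<gamma> \<beta> x n = markov_order Q (\<lambda>j x. x j)) sequentially"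
proof -
  define K where "K = markov_order Q (\<lambda>j x. x j)"
  have K: "markov_with Q (\<lambda>j x. x j) K"
    using assms(4) unfolding K_def markov_order_def markov_chain_def by (rule LeastI_ex)
  have "\<not> markov_with Q (\<lambda>j x. x j) j" if "j < K" for j
    using that not_less_Least unfolding K_def markov_order_def by blast
  then have "AE x in Q. eventually (\<lambda>n. K \<le> chi \<gamma> \<beta> x n) sequentially"
    using assms by (intro eventually_chi_ge) auto
  moreover have "AE x in Q. eventually (\<lambda>n. Delta_hat \<gamma> x n K \<le> real n powr (- \<beta>)) sequentially"
    using assms K by (intro eventually_Delta_hat_le)
  ultimately show ?thesis
  proof eventually_elim
    case (elim x)
    \<comment> \<open>Only orders below \<open>n\<close> compete in \<open>chi\<close>, so
      \<open>n\<close> must exceed \<open>K\<close>.\<close>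
    from elim eventually_gt_at_top[of K] show ?case unfolding K_def[symmetric]
      by eventually_elim (auto intro: antisym chi_le)
  qed
qed

text \<open>Every order is wrong, so \<open>eventually_chi_ge\<close> applies to each bound
  \<open>k\<close>, and countably many null sets have null union.\<close>

lemma chi_at_top:
  assumes "0 < \<gamma>" "0 < \<beta>" and "\<not> markov_chain Q (\<lambda>j x. x j)"
  shows "AE x in Q. filterlim (\<lambda>n. chi \<gamma> \<beta> x n) at_top sequentially"
  unfolding filterlim_at_top AE_all_countable
  using assms by (auto simp: markov_chain_def intro!: eventually_chi_ge)

end

section \<open>Transfer from a time series to its law\<close>

lemma measurable_path:
  assumes "time_series M X"
  shows "(\<lambda>\<omega> n. X n \<omega>) \<in> measurable M seq_space"
  using assms by (intro measurable_PiM_single') (auto simp: time_series_def)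

lemma ergodic_law_distr:
  fixes X :: "int \<Rightarrow> 'w \<Rightarrow> 'a::countable"
  assumes ts: "time_series M X" and st: "stationary M X" and er: "ergodic M X"
  shows "ergodic_law (distr M seq_space (\<lambda>\<omega> n. X n \<omega>))"
proof -
  define Q where "Q = distr M seq_space (\<lambda>\<omega> n. X n \<omega>)"
  interpret M: prob_space M using ts by (simp add: time_series_def)
  interpret Q: prob_space Q
    unfolding Q_def by (rule M.prob_space_distr[OF measurable_path[OF ts]])
  have "ergodic_law Q"
  proof
    show "sets Q = sets seq_space" by (simp add: Q_def)
    show "distr Q seq_space (\<lambda>x n. x (n + h)) = Q" for h
    proof -
      have s: "(\<lambda>x n. x (n + h)) \<in> measurable seq_space (seq_space :: (int \<Rightarrow> 'a) measure)"
        by (rule measurable_PiM_single') (auto simp: space_PiM intro: measurable_component_singleton)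
      have "distr Q seq_space (\<lambda>x n. x (n + h)) = distr M seq_space (\<lambda>\<omega> n. X (n + h) \<omega>)"
        unfolding Q_def using distr_distr[OF s measurable_path[OF ts]] by (simp add: comp_def)
      then show ?thesis using st by (simp add: stationary_def Q_def)
    qed
    show "measure Q A \<in> {0, 1}" if "A \<in> sets Q" "shift -` A = A" for A
      using that er by (simp add: ergodic_def Q_def)
  qed
  then show ?thesis by (simp add: Q_def)
qed

text \<open>Everything in \<open>markov_with\<close> is built from probabilities of block events,
  which a series shares with its law.\<close>

lemma markov_with_distr:
  fixes X :: "int \<Rightarrow> 'w \<Rightarrow> 'a::countable"
  assumes ts: "time_series M X"
  shows "markov_with (distr M seq_space (\<lambda>\<omega> n. X n \<omega>)) (\<lambda>j x. x j) = markov_with M X"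
proof -
  define Q where "Q = distr M seq_space (\<lambda>\<omega> n. X n \<omega>)"
  have P: "measure Q {x. R (block x m n)} = measure M {\<omega> \<in> space M. R (block (\<lambda>j. X j \<omega>) m n)}"
    for R :: "'a list \<Rightarrow> bool" and m n
  proof -
    have "(\<lambda>x :: int \<Rightarrow> 'a. block x m n) \<in> measurable seq_space (count_space UNIV)"
      unfolding block_def by (rule measurable_map_seq)
    from measurable_sets[OF this, of "{u. R u}"]
    have "{x. R (block x m n)} \<in> sets (seq_space :: (int \<Rightarrow> 'a) measure)"
      by (simp add: vimage_def space_PiM)
    then show ?thesis
      unfolding Q_def using measurable_path[OF ts] by (subst measure_distr) (auto intro!: arg_cong[where f = "measure M"])
  qed
  have sp: "space Q = UNIV" by (simp add: Q_def space_PiM)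
  have str: "str_prob Q (\<lambda>j x. x j) z = str_prob M X z" for z
    using P[of "\<lambda>v. v = z"] by (simp add: str_prob_def sp)
  have "next_prob Q (\<lambda>j x. x j) y z = next_prob M X y z" for y z
  proof -
    have sn: "block x (1 - int (length z)) 1 = block x (1 - int (length z)) 0 @ [x 1]" for x :: "int \<Rightarrow> 'a"
      using block_snoc[of "1 - int (length z)" 0 x] by simp
    show ?thesis
      using P[of "\<lambda>v. v = z"  "1 - int (length z)" 0] P[of "\<lambda>v. v = z @ [y]" "1 - int (length z)" 1]
      by (simp add: next_prob_def cond_prob_def sp sn conj_commute)
  qed
  then show ?thesis
    unfolding Q_def[symmetric] markov_with_def str fun_eq_iff by simp
qed

theorem mainTheorem1:
  fixes M :: "'w measure"
    and X :: "int \<Rightarrow> 'w \<Rightarrow> 'a::countable"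
    and \<gamma> \<beta> :: real
  assumes "0 < \<gamma>" and "\<gamma> < 1"
    and "0 < \<beta>" and "\<beta> < (1 - \<gamma>) / 2"
    and "time_series M X" and "stationary M X" and "ergodic M X"
  shows "(markov_chain M X \<longrightarrow>
            (AE \<omega> in M. \<forall>\<^sub>F n in sequentially.
               chi \<gamma> \<beta> (\<lambda>j. X j \<omega>) n = markov_order M X))
       \<and> (\<not> markov_chain M X \<longrightarrow>
            (AE \<omega> in M. filterlim (\<lambda>n. chi \<gamma> \<beta> (\<lambda>j. X j \<omega>) n) at_top sequentially))"
proof -
  define Q where "Q = distr M seq_space (\<lambda>\<omega> n. X n \<omega>)"
  interpret ergodic_law Q
    unfolding Q_def using assms by (intro ergodic_law_distr)
  have transfer: "AE \<omega> in M. R (\<lambda>j. X j \<omega>)" if "AE x in Q. R x" for R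
    using AE_distrD[OF measurable_path[OF assms(5)]] that unfolding Q_def by blast
  have "markov_with Q (\<lambda>j x. x j) = markov_with M X"
    unfolding Q_def by (rule markov_with_distr[OF assms(5)])
  then have mc: "markov_chain Q (\<lambda>j x. x j) = markov_chain M X"
    and mo: "markov_order Q (\<lambda>j x. x j) = markov_order M X"
    by (simp_all add: markov_chain_def markov_order_def)
  show ?thesis
    using transfer[OF eventually_chi_eq_markov_order[OF assms(1,3,4)]]
      transfer[OF chi_at_top[OF assms(1,3)]]
    unfolding mc mo by blast
qed

end
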